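(* Let $n\ge1$ and let $f:\mathbb R^n\to\mathbb R$ be a continuous function which has continuous derivatives, such that, for all $x\in\mathbb R^n$, $w\in S_n$, $r\in\mathbb Z^n$ and $i=1,\dots,n$, $$f(wx+r)=f(x),\qquad f(\varepsilon_ix)=-f(x).$$ Then $f$ has the expansion $$f(x)=\sum_{m\in P_+}c_m\,\sin^+_m(x),$$ where the coefficients are given by $$c_m=2^{2n}\,|G_m|^{-1}\int_{\overline F}f(x)\,\sin^+_m(x)\,dx .$$ The Plancherel formula is $$\sum_{m\in P_+}|G_m|\,|c_m|^2=2^{2n}\int_{\overline F}|f(x)|^2dx .$$
   Context: The symmetric group $S_n$ acts on $\mathbb R^n$ by permuting coordinates and $\varepsilon_i$ changes the sign of the coordinate $x_i$. $\overline F=\{x\in\mathbb R^n:\tfrac12\ge x_1\ge x_2\ge\cdots\ge x_n\ge0\}$. $P_+=\{m\in\mathbb Z^n: m_1\ge m_2\ge\cdots\ge m_n\ge0\}$. $G_m\subset S_n$ is the subgroup of permutations leaving the $n$-tuple $m$ invariant and $|G_m|$ is its order. $\sin^+_m(x)=\sum_{w\in S_n}\prod_{j=1}^n\sin(2\pi m_{w(j)}x_j)$. *)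

theory Defs
  imports "HOL-Analysis.Analysis" "HOL-Combinatorics.Permutations"
begin

(* R^n is real ^ 'n with 'n a finite linearly ordered index type and n = CARD('n); the order on
   'n plays the role of 1 < 2 < ... < n, and n >= 1 holds because types are nonempty.
   S_n is the set of all w with "w permutes UNIV". *)

definition perm_act :: "('n \<Rightarrow> 'n) \<Rightarrow> 'a ^ 'n \<Rightarrow> 'a ^ 'n" where
  "perm_act w x = (\<chi> i. x $ w i)"

definition sign_flip :: "'n \<Rightarrow> real ^ 'n \<Rightarrow> real ^ 'n" where
  "sign_flip i x = (\<chi> j. if j = i then - (x $ j) else x $ j)"

definition int_vec :: "int ^ 'n \<Rightarrow> real ^ 'n" where
  "int_vec r = (\<chi> i. real_of_int (r $ i))"

definition F_closed :: "(real ^ 'n::{finite,linorder}) set" where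
  "F_closed = {x. (\<forall>i. 0 \<le> x $ i \<and> x $ i \<le> 1 / 2) \<and> (\<forall>i j. i \<le> j \<longrightarrow> x $ j \<le> x $ i)}"

definition P_plus :: "(int ^ 'n::{finite,linorder}) set" where
  "P_plus = {m. (\<forall>i. 0 \<le> m $ i) \<and> (\<forall>i j. i \<le> j \<longrightarrow> m $ j \<le> m $ i)}"

definition stab :: "int ^ 'n \<Rightarrow> ('n \<Rightarrow> 'n) set" where
  "stab m = {w. w permutes UNIV \<and> perm_act w m = m}"

definition sin_plus :: "int ^ 'n \<Rightarrow> real ^ 'n \<Rightarrow> real" where
  "sin_plus m x =
     (\<Sum>w | w permutes UNIV. \<Prod>j\<in>UNIV. sin (2 * pi * real_of_int (m $ w j) * x $ j))"

definition sin_plus_coeff :: "(real ^ 'n::{finite,linorder} \<Rightarrow> real) \<Rightarrow> int ^ 'n::{finite,linorder} \<Rightarrow> real" where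
  "sin_plus_coeff f m =
     2 ^ (2 * CARD('n)) * inverse (real (card (stab m))) * (LINT x:F_closed|lborel. f x * sin_plus m x)"

definition continuous_partial_derivs :: "(real ^ 'n \<Rightarrow> real) \<Rightarrow> bool" where
  "continuous_partial_derivs f \<longleftrightarrow>
     (\<forall>i. \<exists>g. continuous_on UNIV g \<and>
        (\<forall>x. ((\<lambda>t. f (x + t *\<^sub>R axis i 1)) has_real_derivative g x) (at 0)))"

(* The cube truncation m_1 <= N of P_+, used for the partial sums of the expansion: for functions
   that are only C^1 the series need not converge absolutely when n > 1, so it has to be summed
   in an order. *)
definition P_plus_upto :: "nat \<Rightarrow> (int ^ 'n::{finite,linorder}) set" where
  "P_plus_upto N = {m \<in> P_plus. \<forall>i. m $ i \<le> int N}"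

lemma finite_P_plus_upto: "finite (P_plus_upto N :: (int ^ 'n::{finite,linorder}) set)"
proof (rule finite_subset)
  let ?A = "Pi\<^sub>E (UNIV :: 'n set) (\<lambda>_. {0..int N})"
  show "P_plus_upto N \<subseteq> vec_lambda ` ?A"
  proof
    fix m :: "int ^ 'n::{finite,linorder}"
    assume "m \<in> P_plus_upto N"
    then have "vec_nth m \<in> ?A"
      by (auto simp: P_plus_upto_def P_plus_def)
    then show "m \<in> vec_lambda ` ?A"
      by (metis image_eqI vec_nth_inverse)
  qed
  show "finite (vec_lambda ` ?A)"
    by (intro finite_imageI finite_PiE) auto
qed

end

(* Unfolding the orbits of S_n turns the partial sum over the cube into the integral of f against
   a product of one-dimensional Dirichlet-type sine kernels over [0,1/2]^n.  In one variable the
   partial sum of a C^1 function h equals h plus the integral of h' against the remainder R_N of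
   the sawtooth series; the L^2 norm of R_N is the tail of the Basel series, so the error is
   O(N^(-1/2)), while the kernels have L^1 norm O(log N).  Replacing the coordinates one at a time
   gives the uniform error O(N^(-1/2) (log N)^(n-1)), and the Plancherel formula follows by
   integrating the uniformly convergent expansion against f. *)
theory Submission
  imports Defs "HOL-Real_Asymp.Real_Asymp"
begin

section \<open>Dirichlet kernels in one variable\<close>

definition dirichlet :: "nat \<Rightarrow> real \<Rightarrow> real" where
  "dirichlet N t = 1 + 2 * (\<Sum>k=1..N. cos (2 * pi * real k * t))"

text \<open>On (0,1) the sine series of \<open>1 / 2 - t\<close> is the full version of the
  subtracted sum, so this is its tail there. It is a non-periodic antiderivative of
  \<open>- dirichlet N\<close>; the drop from 1/2 at 0 to -1/2 at 1 plays the part of the delta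
  function.\<close>

definition sawtooth_rem :: "nat \<Rightarrow> real \<Rightarrow> real" where
  "sawtooth_rem N t = 1 / 2 - t - (\<Sum>k=1..N. sin (2 * pi * real k * t) / (pi * real k))"

lemma sin_2pi_nat [simp]: "sin (2 * pi * real k) = 0"
  using sin_2npi[of k] by (simp add: mult_ac)

lemma cos_2pi_nat [simp]: "cos (2 * pi * real k) = 1"
  using cos_2npi[of k] by (simp add: mult_ac)

lemma dirichlet_periodic: "dirichlet N (t + 1) = dirichlet N t"
  by (simp add: dirichlet_def ring_distribs cos_add)

lemma dirichlet_minus: "dirichlet N (- t) = dirichlet N t"
  by (simp add: dirichlet_def)

lemma continuous_on_dirichlet [continuous_intros]:
  fixes g :: "'a::t2_space \<Rightarrow> real"
  shows "continuous_on S g \<Longrightarrow> continuous_on S (\<lambda>x. dirichlet N (g x))"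
  unfolding dirichlet_def by (intro continuous_intros)

lemma sawtooth_rem_deriv:
  "(sawtooth_rem N has_real_derivative - dirichlet N t) (at t within S)"
  unfolding sawtooth_rem_def dirichlet_def
  by (auto intro!: derivative_eq_intros sum.cong simp: sum_distrib_left)

lemma continuous_on_sawtooth_rem [continuous_intros]: "continuous_on S (sawtooth_rem N)"
  by (rule DERIV_continuous_on) (rule sawtooth_rem_deriv)

section \<open>Orthogonality of sines and the size of the sawtooth remainder\<close>

lemma has_integral_cos_2pi:
  assumes "k \<noteq> (0::int)"
  shows "((\<lambda>t. cos (2 * pi * of_int k * t)) has_integral 0) {0..1}"
proof -
  have "((\<lambda>t. cos (2 * pi * of_int k * t)) has_integral
      (sin (2 * pi * of_int k * 1) / (2 * pi * of_int k) - sin (2 * pi * of_int k * 0) / (2 * pi * of_int k))) {0..1}"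
    using assms
    by (intro fundamental_theorem_of_calculus)
       (auto intro!: derivative_eq_intros simp: has_real_derivative_iff_has_vector_derivative[symmetric])
  then show ?thesis by (simp add: sin_int_2pin)
qed

lemma has_integral_sin_sin:
  assumes "k > 0" "m > (0::nat)"
  shows "((\<lambda>t. sin (2 * pi * real k * t) * sin (2 * pi * real m * t)) has_integral
     (if k = m then 1 / 2 else 0)) {0..1}"
proof -
  have eq: "sin (2 * pi * real k * t) * sin (2 * pi * real m * t) =
     1 / 2 * cos (2 * pi * of_int (int k - int m) * t) - 1 / 2 * cos (2 * pi * of_int (int k + int m) * t)" for t
    by (simp add: ring_distribs cos_add cos_diff)
  have 1: "((\<lambda>t. cos (2 * pi * of_int (int k + int m) * t)) has_integral 0) {0..1}"
    by (intro has_integral_cos_2pi) (use assms in auto)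
  have 2: "((\<lambda>t. cos (2 * pi * of_int (int k - int m) * t)) has_integral (if k = m then 1 else 0)) {0..1}"
  proof (cases "k = m")
    case True
    then show ?thesis using has_integral_const_real[of "1::real" 0 1] by simp
  next
    case False
    then show ?thesis using has_integral_cos_2pi[of "int k - int m"] by simp
  qed
  show ?thesis
    unfolding eq
    by (rule has_integral_eq_rhs[OF has_integral_diff[OF has_integral_mult_right[OF 2] has_integral_mult_right[OF 1]]]) simp
qed

lemma has_integral_linear_sin:
  assumes "m > (0::nat)"
  shows "((\<lambda>t. (1 / 2 - t) * sin (2 * pi * real m * t)) has_integral 1 / (2 * pi * real m)) {0..1}"
proof -
  let ?c = "2 * pi * real m"
  let ?F = "\<lambda>t. - (1 / 2 - t) * cos (?c * t) / ?c - sin (?c * t) / ?c\<^sup>2"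
  have "((\<lambda>t. (1 / 2 - t) * sin (?c * t)) has_integral (?F 1 - ?F 0)) {0..1}"
    using assms
    by (intro fundamental_theorem_of_calculus)
       (auto intro!: derivative_eq_intros
          simp: has_real_derivative_iff_has_vector_derivative[symmetric] field_simps power2_eq_square)
  then show ?thesis
    by (rule has_integral_eq_rhs) (simp only: mult_1_right sin_2pi_nat cos_2pi_nat, simp)
qed

text \<open>The subtracted frequencies k \<le> N < m are orthogonal to the m-th sine, so only the
  contribution of \<open>1 / 2 - t\<close> survives.\<close>

lemma sawtooth_rem_orthogonal:
  assumes "N < m"
  shows "((\<lambda>t. sawtooth_rem N t * sin (2 * pi * real m * t)) has_integral 1 / (2 * pi * real m)) {0..1}"
proof -
  have "((\<lambda>t. (1 / 2 - t) * sin (2 * pi * real m * t) -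
      (\<Sum>k=1..N. 1 / (pi * real k) * (sin (2 * pi * real k * t) * sin (2 * pi * real m * t))))
      has_integral 1 / (2 * pi * real m) - (\<Sum>k=1..N. 1 / (pi * real k) * 0)) {0..1}"
    using assms
    by (intro has_integral_diff has_integral_linear_sin has_integral_sum has_integral_mult_right)
       (auto dest: has_integral_sin_sin[of _ m] split: if_splits
          intro!: has_integral_eq_rhs[OF has_integral_sin_sin])
  then show ?thesis
    by (simp add: sawtooth_rem_def left_diff_distrib sum_distrib_right mult.assoc)
qed

text \<open>Parseval for the sawtooth, removing one frequency at a time: the cross term contributes
  -1/(pi m)^2 and the square +1/(2 (pi m)^2). The value 1/12 is the integral of (1/2 - t)^2.\<close>

lemma sawtooth_rem_L2:
  "((\<lambda>t. (sawtooth_rem N t)\<^sup>2) has_integral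
      1 / 12 - (\<Sum>k=1..N. 1 / (2 * pi\<^sup>2 * (real k)\<^sup>2))) {0..1}"
proof (induction N)
  case 0
  have "((\<lambda>t::real. (1 / 2 - t)\<^sup>2) has_integral (- ((1/2 - 1) ^ 3 / 3) - (- ((1/2 - 0) ^ 3 / 3)))) {0..1}"
    by (intro fundamental_theorem_of_calculus)
       (auto intro!: derivative_eq_intros
          simp: has_real_derivative_iff_has_vector_derivative[symmetric] field_simps power2_eq_square)
  then show ?case by (simp add: sawtooth_rem_def power3_eq_cube)
next
  case (Suc N)
  let ?m = "Suc N"
  let ?s = "\<lambda>t. sin (2 * pi * real ?m * t)"
  let ?q = "1 / (pi * real ?m)"
  have eq: "(sawtooth_rem ?m t)\<^sup>2 = (sawtooth_rem N t)\<^sup>2 -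
      2 * ?q * (sawtooth_rem N t * ?s t) + ?q\<^sup>2 * (?s t * ?s t)" for t
  proof -
    have "sawtooth_rem ?m t = sawtooth_rem N t - ?q * ?s t"
      by (simp add: sawtooth_rem_def)
    then show ?thesis by (simp only:) (simp add: power2_eq_square algebra_simps)
  qed
  have "((\<lambda>t. (sawtooth_rem ?m t)\<^sup>2) has_integral
      (1 / 12 - (\<Sum>k=1..N. 1 / (2 * pi\<^sup>2 * (real k)\<^sup>2))) - 2 * ?q * (1 / (2 * pi * real ?m))
        + ?q\<^sup>2 * (if ?m = ?m then 1 / 2 else 0)) {0..1}"
    unfolding eq
    by (intro has_integral_add has_integral_diff has_integral_mult_right Suc.IH
        sawtooth_rem_orthogonal has_integral_sin_sin) auto
  then show ?case
    by (rule has_integral_eq_rhs) (simp add: field_simps power2_eq_square)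
qed

text \<open>Since 1/(n+1)^2 \<le> 1/n - 1/(n+1), the right-hand side decreases in N, and its limit
  is the Basel value.\<close>

lemma basel_tail:
  assumes "N > 0"
  shows "pi\<^sup>2 / 6 \<le> (\<Sum>k=1..N. 1 / (real k)\<^sup>2) + 1 / real N"
proof -
  define a where "a N = (\<Sum>k=1..N. 1 / (real k)\<^sup>2) + 1 / real N" for N
  have dec: "a (Suc n) \<le> a n" if "n > 0" for n
  proof -
    have "1 / (real (Suc n))\<^sup>2 \<le> 1 / (real n * real (Suc n))"
      using that by (intro divide_left_mono) (auto simp: power2_eq_square)
    also have "\<dots> = 1 / real n - 1 / real (Suc n)"
      using that by (simp add: field_simps)
    finally show ?thesis by (simp add: a_def)
  qed
  have "(\<lambda>n. \<Sum>k<n. 1 / (real k + 1)\<^sup>2) \<longlonglongrightarrow> pi\<^sup>2 / 6"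
    using inverse_squares_sums by (simp add: sums_def add.commute)
  moreover have "(\<Sum>k<n. 1 / (real k + 1)\<^sup>2) = (\<Sum>k=1..n. 1 / (real k)\<^sup>2)" for n
    by (rule sum.reindex_bij_witness[where i = "\<lambda>k. k - 1" and j = Suc]) auto
  ultimately have "(\<lambda>n. \<Sum>k=1..n. 1 / (real k)\<^sup>2) \<longlonglongrightarrow> pi\<^sup>2 / 6"
    by simp
  from tendsto_add[OF this lim_inverse_n'] have "a \<longlonglongrightarrow> pi\<^sup>2 / 6"
    by (simp add: a_def[abs_def])
  moreover have "a n \<le> a N" if "n \<ge> N" for n
    using that
  proof (induction rule: dec_induct)
    case (step m)
    then show ?case using dec[of m] assms by simp
  qed simp
  ultimately have "pi\<^sup>2 / 6 \<le> a N"
    by (meson LIMSEQ_le_const2)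
  then show ?thesis by (simp add: a_def)
qed

text \<open>Cauchy-Schwarz in the form of a weighted AM-GM inequality, |R| \<le> (R^2/c + c)/2. The
  weight c = N^(-1/2) balances the two terms, because the L2 integral is at most 1/(2 pi^2 N), which
  is rounded up to 1/N = c^2.\<close>

lemma sawtooth_rem_L1:
  assumes "N > 0"
  shows "integral {0..1} (\<lambda>t. \<bar>sawtooth_rem N t\<bar>) \<le> 1 / sqrt (real N)"
proof -
  define c where "c = 1 / sqrt (real N)"
  have c: "c > 0" "c\<^sup>2 = 1 / N"
    using assms by (auto simp: c_def power_divide)
  let ?I = "1 / 12 - (\<Sum>k=1..N. 1 / (2 * pi\<^sup>2 * (real k)\<^sup>2))"
  have "?I = 1 / (2 * pi\<^sup>2) * (pi\<^sup>2 / 6 - (\<Sum>k=1..N. 1 / (real k)\<^sup>2))"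
    by (simp add: right_diff_distrib sum_distrib_left)
  also have "\<dots> \<le> 1 / (2 * pi\<^sup>2) * (1 / real N)"
    using basel_tail[OF assms] by (intro mult_left_mono) auto
  also have "\<dots> \<le> 1 * (1 / real N)"
  proof (intro mult_right_mono)
    have "1 \<le> pi\<^sup>2" using pi_gt3 by (intro one_le_power) simp
    then show "1 / (2 * pi\<^sup>2) \<le> 1" by simp
  qed auto
  finally have I: "?I \<le> c\<^sup>2" using c by simp
  have "integral {0..1} (\<lambda>t. \<bar>sawtooth_rem N t\<bar>) \<le> (?I / c + c * 1) / 2"
  proof (rule integral_le[THEN order_trans])
    have R: "((\<lambda>t. ((sawtooth_rem N t)\<^sup>2 / c + c * 1) / 2) has_integral (?I / c + c * 1) / 2) {0..1}"
      using has_integral_const_real[of "1::real" 0 1]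
      by (intro has_integral_divide has_integral_add has_integral_mult_right sawtooth_rem_L2) simp
    show "(\<lambda>t. ((sawtooth_rem N t)\<^sup>2 / c + c * 1) / 2) integrable_on {0..1}"
      using R by blast
    show "integral {0..1} (\<lambda>t. ((sawtooth_rem N t)\<^sup>2 / c + c * 1) / 2) \<le> (?I / c + c * 1) / 2"
      using integral_unique[OF R] by simp
    show "(\<lambda>t. \<bar>sawtooth_rem N t\<bar>) integrable_on {0..1}"
      by (intro integrable_continuous_real continuous_intros)
    show "\<bar>sawtooth_rem N t\<bar> \<le> ((sawtooth_rem N t)\<^sup>2 / c + c * 1) / 2" for t
    proof -
      have "0 \<le> (\<bar>sawtooth_rem N t\<bar> - c)\<^sup>2" by simp
      then have "2 * c * \<bar>sawtooth_rem N t\<bar> \<le> (sawtooth_rem N t)\<^sup>2 + c\<^sup>2"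
        by (simp add: power2_diff algebra_simps)
      then show ?thesis using c by (simp add: field_simps power2_eq_square)
    qed
  qed
  also have "\<dots> \<le> c"
    using I c by (simp add: field_simps power2_eq_square)
  finally show ?thesis by (simp add: c_def)
qed

lemma dirichlet_convolution_error:
  fixes h h' :: "real \<Rightarrow> real"
  assumes der: "\<And>t. (h has_real_derivative h' t) (at t)"
    and cont: "continuous_on UNIV h'" and bd: "\<And>t. \<bar>h' t\<bar> \<le> M"
    and per: "\<And>t. h (t + 1) = h t" and N: "N > 0"
  shows "\<bar>integral {0..1} (\<lambda>t. h (x + t) * dirichlet N t) - h x\<bar> \<le> M / sqrt (real N)"
proof -
  have conth: "continuous_on S (\<lambda>t. h (x + t))" for S
    by (rule continuous_on_compose2[of UNIV h])
       (auto intro!: continuous_intros DERIV_continuous_on[OF has_field_derivative_at_within[OF der]])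
  have conth': "continuous_on S (\<lambda>t. h' (x + t))" for S
    by (rule continuous_on_compose2[OF cont]) (auto intro!: continuous_intros)
  have dh: "((\<lambda>t. h (x + t)) has_real_derivative h' (x + t)) (at t within S)" for t S
  proof (rule has_field_derivative_at_within)
    show "((\<lambda>t. h (x + t)) has_real_derivative h' (x + t)) (at t)"
      using der[of "t + x"] by (simp add: DERIV_shift add.commute)
  qed
  let ?F = "\<lambda>t. h (x + t) * sawtooth_rem N t"
  have "((\<lambda>t. h' (x + t) * sawtooth_rem N t - h (x + t) * dirichlet N t) has_integral (?F 1 - ?F 0)) {0..1}"
    by (intro fundamental_theorem_of_calculus)
       (auto intro!: derivative_eq_intros dh sawtooth_rem_deriv
         simp: has_real_derivative_iff_has_vector_derivative[symmetric])
  \<comment> \<open>All sines vanish at 0 and 1, so the boundary terms of the integration by parts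
    are -1/2 times \<open>h (x + 1)\<close> and -1/2 times \<open>h x\<close>; periodicity merges
    them into the point value.\<close>
  moreover have "?F 1 - ?F 0 = - h x"
    using per[of x] by (simp add: sawtooth_rem_def)
  moreover have i1: "(\<lambda>t. h' (x + t) * sawtooth_rem N t) integrable_on {0..1}"
    and i2: "(\<lambda>t. h (x + t) * dirichlet N t) integrable_on {0..1}"
    by (intro integrable_continuous_real continuous_intros conth conth')+
  ultimately have eq: "integral {0..1} (\<lambda>t. h (x + t) * dirichlet N t) - h x =
      integral {0..1} (\<lambda>t. h' (x + t) * sawtooth_rem N t)"
    using integral_diff[OF i1 i2] by (simp add: has_integral_iff)
  have "\<bar>integral {0..1} (\<lambda>t. h' (x + t) * sawtooth_rem N t)\<bar> \<le>
      integral {0..1} (\<lambda>t. M * \<bar>sawtooth_rem N t\<bar>)"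
    by (rule Henstock_Kurzweil_Integration.integral_norm_bound_integral[OF i1, unfolded real_norm_def])
       (auto intro!: integrable_continuous_real continuous_intros mult_right_mono bd simp: abs_mult)
  also have "\<dots> \<le> M * (1 / sqrt (real N))"
    using sawtooth_rem_L1[OF N] bd[of 0] by (simp only: integral_mult_right) (intro mult_left_mono, auto)
  finally show ?thesis using eq by simp
qed

section \<open>Logarithmic L1 bound for the Dirichlet kernel\<close>

lemma dirichlet_mult_sin: "dirichlet N t * sin (pi * t) = sin ((2 * real N + 1) * pi * t)"
proof (induction N)
  case 0
  then show ?case by (simp add: dirichlet_def)
next
  case (Suc N)
  let ?A = "2 * pi * real (Suc N) * t"
  have "dirichlet (Suc N) t * sin (pi * t) = sin ((2 * real N + 1) * pi * t) + 2 * cos ?A * sin (pi * t)"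
    using Suc.IH by (simp add: dirichlet_def algebra_simps)
  also have "(2 * real N + 1) * pi * t = ?A - pi * t"
    by (simp add: algebra_simps)
  also have "sin (?A - pi * t) + 2 * cos ?A * sin (pi * t) = sin (?A + pi * t)"
    by (simp add: sin_add sin_diff)
  also have "?A + pi * t = (2 * real (Suc N) + 1) * pi * t"
    by (simp add: algebra_simps)
  finally show ?case .
qed

text \<open>Jordan's inequality: the concave sine lies above its chord from 0 to
  \<open>pi / 2\<close>.\<close>

lemma sin_pi_ge:
  assumes "0 \<le> t" "t \<le> 1 / 2"
  shows "2 * t \<le> sin (pi * t)"
proof -
  have "concave_on {0..pi / 2} sin"
    by (rule f''_le0_imp_concave[where f' = cos and f'' = "\<lambda>x. - sin x"])
       (auto intro!: derivative_eq_intros sin_ge_zero)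
  from concave_onD[OF this, of "2 * t" 0 "pi / 2"] assms show ?thesis
    by (simp add: mult.commute)
qed

text \<open>Sum of two estimates: |D| / (2N+1) \<le> 1 by counting terms, and 2t |D| \<le> 1 from
  the closed form multiplied by \<open>sin (pi * t)\<close>. Adding them gives one majorant that is
  finite at 0 and has an elementary antiderivative, so the interval need not be split near
  0.\<close>

lemma dirichlet_bound_half:
  assumes "0 \<le> t" "t \<le> 1 / 2"
  shows "\<bar>dirichlet N t\<bar> \<le> 2 / (2 * t + 1 / (2 * real N + 1))"
proof -
  have "\<bar>\<Sum>k=1..N. cos (2 * pi * real k * t)\<bar> \<le> (\<Sum>k=1..N. 1)"
    by (rule order_trans[OF sum_abs]) (intro sum_mono, auto)
  then have "\<bar>dirichlet N t\<bar> \<le> 2 * real N + 1"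
    unfolding dirichlet_def by simp
  then have 1: "\<bar>dirichlet N t\<bar> * (1 / (2 * real N + 1)) \<le> 1"
    by (simp add: field_simps)
  have "\<bar>dirichlet N t\<bar> * (2 * t) \<le> \<bar>dirichlet N t\<bar> * sin (pi * t)"
    using sin_pi_ge[OF assms] by (intro mult_left_mono) auto
  also have "\<dots> \<le> \<bar>dirichlet N t * sin (pi * t)\<bar>"
    by (simp add: abs_mult mult_left_mono)
  also have "\<dots> \<le> 1"
    by (simp add: dirichlet_mult_sin)
  finally have "\<bar>dirichlet N t\<bar> * (2 * t + 1 / (2 * real N + 1)) \<le> 2"
    using 1 by (simp only: ring_distribs)
  moreover have "2 * t + 1 / (2 * real N + 1) > 0"
    using assms by (intro add_nonneg_pos) auto
  ultimately show ?thesis by (simp only: pos_le_divide_eq)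
qed

text \<open>The half-period majorant and its reflection at 1/2 are both positive, so their sum
  dominates on all of [0,1]. Each summand integrates to \<open>ln ((2 + a) / a)\<close>, and the
  quotient is 4N + 3.\<close>

lemma dirichlet_L1:
  "integral {0..1} (\<lambda>t. \<bar>dirichlet N t\<bar>) \<le> 2 * ln (4 * real N + 3)"
proof -
  define a where "a = 1 / (2 * real N + 1)"
  have a: "a > 0" by (simp add: a_def)
  let ?u = "\<lambda>t. 2 / (2 * t + a) + 2 / (2 * (1 - t) + a)"
  let ?F = "\<lambda>t. ln (2 * t + a) - ln (2 * (1 - t) + a)"
  have pos: "2 * t + a > 0" "2 * (1 - t) + a > 0" "2 - 2 * t + a > 0" if "0 \<le> t" "t \<le> 1" for t
    using that a by auto
  have hi: "(?u has_integral (?F 1 - ?F 0)) {0..1}"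
    by (intro fundamental_theorem_of_calculus)
       (auto intro!: derivative_eq_intros simp: pos
         has_real_derivative_iff_has_vector_derivative[symmetric])
  have "integral {0..1} (\<lambda>t. \<bar>dirichlet N t\<bar>) \<le> integral {0..1} ?u"
  proof (rule integral_le)
    show "(\<lambda>t. \<bar>dirichlet N t\<bar>) integrable_on {0..1}"
      by (intro integrable_continuous_real continuous_intros)
    show "?u integrable_on {0..1}" using hi by blast
    show "\<bar>dirichlet N t\<bar> \<le> ?u t" if t: "t \<in> {0..1}" for t
    proof (cases "t \<le> 1 / 2")
      case True
      then have "\<bar>dirichlet N t\<bar> \<le> 2 / (2 * t + a)"
        using dirichlet_bound_half[of t N] t by (simp add: a_def)
      also have "\<dots> \<le> ?u t" using pos[of t] t by simp
      finally show ?thesis .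
    next
      case False
      have "dirichlet N t = dirichlet N (1 - t)"
        using dirichlet_periodic[of N "- t"] by (simp add: dirichlet_minus)
      then have "\<bar>dirichlet N t\<bar> \<le> 2 / (2 * (1 - t) + a)"
        using dirichlet_bound_half[of "1 - t" N] t False by (simp add: a_def)
      also have "\<dots> \<le> ?u t" using pos[of t] t by simp
      finally show ?thesis .
    qed
  qed
  also have "\<dots> = 2 * (ln (2 + a) - ln a)"
    using integral_unique[OF hi] by simp
  also have "ln (2 + a) - ln a = ln ((2 + a) / a)"
    using a by (simp add: ln_div)
  also have "(2 + a) / a = 4 * real N + 3"
    by (simp add: a_def field_simps)
  finally show ?thesis .
qed

section \<open>Folding a period onto [0,1/2]: the sine kernel\<close>

lemma integral_periodic_shift:
  fixes g :: "real \<Rightarrow> real"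
  assumes cont: "continuous_on UNIV g" and per: "\<And>t. g (t + 1) = g t"
  shows "integral {a..a + 1} g = integral {b..b + 1} g"
proof -
  obtain G where G: "\<And>t. (G has_vector_derivative g t) (at t)"
    using einterval_antiderivative[of "-\<infinity>" "\<infinity>" g] cont
    by (auto simp: continuous_on_eq_continuous_at)
  have I: "integral {c..c + 1} g = G (c + 1) - G c" for c
    by (intro integral_unique fundamental_theorem_of_calculus)
       (auto intro: has_vector_derivative_at_within G)
  \<comment> \<open>Sliding the window gains g at its right end and loses g at its left end, and
    these agree by periodicity.\<close>
  have "((\<lambda>c. G (c + 1) - G c) has_real_derivative 0) (at c)" for c
  proof -
    have *: "(G has_real_derivative g t) (at t)" for t
      using G by (simp add: has_real_derivative_iff_has_vector_derivative)
    have "((\<lambda>c. G (c + 1)) has_real_derivative g c) (at c)"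
      using *[of "c + 1"] per by (simp add: DERIV_shift)
    from DERIV_diff[OF this *[of c]] show ?thesis by simp
  qed
  then show ?thesis
    unfolding I using DERIV_isconst_all[of "\<lambda>c. G (c + 1) - G c" a b] by blast
qed

text \<open>The factor 4 is the share of one coordinate in 2^(2n). The index starts at 0, where the
  term vanishes, so that products of these kernels run over the same index cube as the orbits of
  \<open>P_plus\<close>, whose tuples may contain zeros.\<close>

definition sine_kernel :: "nat \<Rightarrow> real \<Rightarrow> real \<Rightarrow> real" where
  "sine_kernel N u x = 4 * (\<Sum>k\<le>N. sin (2 * pi * real k * u) * sin (2 * pi * real k * x))"

lemma sine_kernel_eq: "sine_kernel N u x = dirichlet N (u - x) - dirichlet N (u + x)"
proof -
  have "(\<Sum>k\<le>N. sin (2 * pi * real k * u) * sin (2 * pi * real k * x)) =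
    (\<Sum>k=1..N. sin (2 * pi * real k * u) * sin (2 * pi * real k * x))"
    by (rule sum.mono_neutral_right) (auto simp: not_le)
  then show ?thesis
    by (simp add: sine_kernel_def dirichlet_def ring_distribs cos_add cos_diff
        sum.distrib sum_subtractf)
qed

lemma continuous_on_sine_kernel [continuous_intros]: "continuous_on S (\<lambda>u. sine_kernel N u x)"
  unfolding sine_kernel_eq by (intro continuous_intros)

lemma integral_symmetric_interval:
  fixes g :: "real \<Rightarrow> real"
  assumes "continuous_on UNIV g" "0 \<le> a"
  shows "integral {-a..a} g = integral {0..a} (\<lambda>u. g u + g (- u))"
proof -
  have c: "continuous_on S g" "continuous_on S (\<lambda>u. g (- u))" for S
    using assms(1) by (auto intro: continuous_on_subset intro!: continuous_on_compose2[OF assms(1)] continuous_intros)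
  have "integral {-a..a} g = integral {-a..0} g + integral {0..a} g"
    using assms(2) by (intro Henstock_Kurzweil_Integration.integral_combine[symmetric])
      (auto intro!: integrable_continuous_real c)
  also have "integral {-a..0} g = integral {0..a} (\<lambda>u. g (- u))"
    using Henstock_Kurzweil_Integration.integral_reflect_real[of a 0 "\<lambda>u. g (- u)"] by simp
  finally show ?thesis
    by (subst integral_add) (auto intro!: integrable_continuous_real c)
qed

text \<open>The full-period convolution is moved to [-1/2,1/2] by periodicity; there oddness of h
  turns the contribution of -u into minus \<open>h u * dirichlet N (u + x)\<close>, which completes
  the sine kernel.\<close>

lemma sine_kernel_error:
  fixes h h' :: "real \<Rightarrow> real"
  assumes der: "\<And>t. (h has_real_derivative h' t) (at t)"
    and cont: "continuous_on UNIV h'" and bd: "\<And>t. \<bar>h' t\<bar> \<le> M"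
    and per: "\<And>t. h (t + 1) = h t" and odd: "\<And>t. h (- t) = - h t" and N: "N > 0"
  shows "\<bar>integral {0..1 / 2} (\<lambda>u. h u * sine_kernel N u x) - h x\<bar> \<le> M / sqrt (real N)"
proof -
  have conth: "continuous_on S h" for S
    by (rule DERIV_continuous_on[OF has_field_derivative_at_within[OF der]])
  let ?g = "\<lambda>u. h u * dirichlet N (u - x)"
  have cg: "continuous_on UNIV ?g" by (intro continuous_intros conth)
  have "integral {0..1} (\<lambda>t. h (x + t) * dirichlet N t) = integral {x..x + 1} ?g"
    using integral_shift_Icc_real[of 0 1 ?g x] by (simp add: o_def add.commute)
  also have "\<dots> = integral {- (1 / 2)..- (1 / 2) + 1} ?g"
    by (rule integral_periodic_shift[OF cg])
       (metis per dirichlet_periodic add_diff_eq add.commute diff_add_eq)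
  also have "\<dots> = integral {- (1 / 2)..1 / 2} ?g" by simp
  also have "\<dots> = integral {0..1 / 2} (\<lambda>u. ?g u + ?g (- u))"
    by (rule integral_symmetric_interval[OF cg]) simp
  also have "(\<lambda>u. ?g u + ?g (- u)) = (\<lambda>u. h u * sine_kernel N u x)"
  proof
    fix u
    have "dirichlet N (- u - x) = dirichlet N (u + x)"
      using dirichlet_minus[of N "u + x"] by simp
    then show "?g u + ?g (- u) = h u * sine_kernel N u x"
      by (simp add: odd sine_kernel_eq algebra_simps)
  qed
  finally show ?thesis
    using dirichlet_convolution_error[OF der cont bd per N, of x] by simp
qed

text \<open>By the triangle inequality the two Dirichlet kernels on the half period unfold to a
  single one on a full period, so the bound does not double.\<close>

lemma sine_kernel_L1:
  "integral {0..1 / 2} (\<lambda>u. \<bar>sine_kernel N u x\<bar>) \<le> 2 * ln (4 * real N + 3)"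
proof -
  let ?g = "\<lambda>u. \<bar>dirichlet N (u - x)\<bar>"
  have cg: "continuous_on UNIV ?g" by (intro continuous_intros)
  have "integral {0..1 / 2} (\<lambda>u. \<bar>sine_kernel N u x\<bar>) \<le> integral {0..1 / 2} (\<lambda>u. ?g u + ?g (- u))"
  proof (rule integral_le)
    fix u
    have "dirichlet N (- u - x) = dirichlet N (u + x)"
      using dirichlet_minus[of N "u + x"] by simp
    then show "\<bar>sine_kernel N u x\<bar> \<le> ?g u + ?g (- u)"
      by (simp add: sine_kernel_eq)
  qed (auto intro!: integrable_continuous_real continuous_intros)
  also have "\<dots> = integral {- (1 / 2)..1 / 2} ?g"
    by (rule integral_symmetric_interval[OF cg, symmetric]) simp
  also have "\<dots> = integral {- (1 / 2)..- (1 / 2) + 1} ?g" by simp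
  also have "\<dots> = integral {x..x + 1} ?g"
    by (rule integral_periodic_shift[OF cg])
       (metis dirichlet_periodic add_diff_eq add.commute diff_add_eq)
  also have "\<dots> = integral {0..1} (\<lambda>t. \<bar>dirichlet N t\<bar>)"
    using integral_shift_Icc_real[of 0 1 ?g x] by (simp add: o_def add.commute)
  also have "\<dots> \<le> 2 * ln (4 * real N + 3)" by (rule dirichlet_L1)
  finally show ?thesis .
qed

section \<open>Product kernels\<close>

text \<open>Hybrid argument: the coordinates of x are replaced by integration variables one after
  another. Adding a coordinate to j earlier ones causes an error of at most e at each hybrid point,
  and this is integrated against the j earlier kernels, hence at most e L^j. The assumption on e
  concerns one coordinate with the others frozen at arbitrary values.\<close>

lemma product_kernel_error:
  fixes f :: "'a::euclidean_space \<Rightarrow> real" and ker :: "real \<Rightarrow> real \<Rightarrow> real"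
  assumes ker: "\<And>a. integrable lborel (\<lambda>t. ker t a)"
    and L: "\<And>a. (\<integral>t. \<bar>ker t a\<bar> \<partial>lborel) \<le> L"
    and cont: "continuous_on UNIV f" and B: "\<And>x. \<bar>f x\<bar> \<le> B"
    and err: "\<And>x b. b \<in> Basis \<Longrightarrow>
       \<bar>(\<integral>t. f (x + (t - x \<bullet> b) *\<^sub>R b) * ker t (x \<bullet> b) \<partial>lborel) - f x\<bar> \<le> e"
  shows "\<bar>(\<integral>y. f y * (\<Prod>b\<in>Basis. ker (y \<bullet> b) (x \<bullet> b)) \<partial>lborel) - f x\<bar> \<le> e * (\<Sum>j<DIM('a). L ^ j)"
proof -
  interpret product_sigma_finite "\<lambda>_::'a. lborel :: real measure"
    by unfold_locales
  have f_meas [measurable]: "f \<in> borel_measurable borel"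
    using cont by (rule borel_measurable_continuous_onI)
  have ker_meas [measurable]: "(\<lambda>t. ker t a) \<in> borel_measurable borel" for a
    using borel_measurable_integrable[OF ker[of a]] by simp
  have B0: "0 \<le> B" using B[of 0] by simp
  \<comment> \<open>Any basis vector will do: e dominates an absolute value.\<close>
  have e0: "0 \<le> e"
  proof -
    obtain b :: 'a where b: "b \<in> Basis" using nonempty_Basis by blast
    show ?thesis using err[OF b, of 0] by (rule order_trans[rotated]) simp
  qed
  \<comment> \<open>The hybrid point has coordinates from y on I and from x elsewhere; it is x for
    empty I and the integration variable for I = \<open>Basis\<close>.\<close>
  define S where "S I y = (\<Sum>b\<in>I. y b *\<^sub>R b) + (\<Sum>b\<in>Basis - I. (x \<bullet> b) *\<^sub>R b)" for I y
  define P where "P I y = (\<Prod>b\<in>I. ker (y b) (x \<bullet> b))" for I y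
  let ?M = "\<lambda>I::'a set. Pi\<^sub>M I (\<lambda>_. lborel :: real measure)"
  have P_int: "integrable (?M I) (P I)" if "finite I" for I
    unfolding P_def[abs_def] by (rule product_integrable_prod[OF that ker])
  have P_L1: "(\<integral>y. \<bar>P I y\<bar> \<partial>?M I) \<le> L ^ card I" if "finite I" for I
  proof -
    have "(\<integral>y. \<bar>P I y\<bar> \<partial>?M I) = (\<integral>y. (\<Prod>b\<in>I. \<bar>ker (y b) (x \<bullet> b)\<bar>) \<partial>?M I)"
      by (simp add: P_def abs_prod)
    also have "\<dots> = (\<Prod>b\<in>I. \<integral>t. \<bar>ker t (x \<bullet> b)\<bar> \<partial>lborel)"
      by (rule product_integral_prod[OF that integrable_abs[OF ker]])
    also have "\<dots> \<le> (\<Prod>b\<in>I. L)"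
      by (intro prod_mono) (auto intro: L)
    finally show ?thesis by simp
  qed
  have S_meas [measurable]: "S I \<in> borel_measurable (?M I)" if "finite I" for I
    unfolding S_def[abs_def] by measurable
  have fP_int: "integrable (?M I) (\<lambda>y. f (S I y) * P I y)" if "finite I" for I
  proof (rule Bochner_Integration.integrable_bound)
    show "integrable (?M I) (\<lambda>y. B * P I y)" using P_int[OF that] by simp
    show "(\<lambda>y. f (S I y) * P I y) \<in> borel_measurable (?M I)"
      using that P_int[OF that] by measurable
    show "AE y in ?M I. norm (f (S I y) * P I y) \<le> norm (B * P I y)"
      using B B0 by (auto simp: abs_mult intro!: mult_right_mono)
  qed
  have main: "\<bar>(\<integral>y. f (S I y) * P I y \<partial>?M I) - f x\<bar> \<le> e * (\<Sum>j<card I. L ^ j)"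
    if "finite I" "I \<subseteq> Basis" for I
    using that
  proof (induction I rule: finite_induct)
    case empty
    interpret E: finite_measure "?M {}" by rule (simp add: space_PiM)
    have "S {} y = x" for y by (simp add: S_def euclidean_representation)
    then show ?case by (simp add: P_def space_PiM measure_def)
  next
    case (insert i I)
    have iI: "finite (insert i I)" and i: "i \<in> Basis" and IB: "I \<subseteq> Basis" using insert by auto
    \<comment> \<open>G is the inner integral in the new direction i. As i is not in I, the hybrid
      point still has the i-th coordinate of x, so the one-coordinate estimate applies at
      it.\<close>
    define G where "G y = (\<integral>t. f (S I y + (t - x \<bullet> i) *\<^sub>R i) * ker t (x \<bullet> i) \<partial>lborel)" for y
    have Si: "S I y \<bullet> i = x \<bullet> i" for y
    proof -
      have "S I y \<bullet> i = (\<Sum>b\<in>I. y b * (b \<bullet> i)) + (\<Sum>b\<in>Basis - I. (x \<bullet> b) * (b \<bullet> i))"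
        by (simp add: S_def inner_add_left inner_sum_left)
      also have "(\<Sum>b\<in>I. y b * (b \<bullet> i)) = 0"
        using insert.hyps IB i
        by (intro sum.neutral ballI) (metis inner_not_same_Basis mult_zero_right subsetD)
      also have "(\<Sum>b\<in>Basis - I. (x \<bullet> b) * (b \<bullet> i)) = (\<Sum>b\<in>{i}. (x \<bullet> b) * (b \<bullet> i))"
        using insert.hyps i by (intro sum.mono_neutral_right) (auto simp: inner_Basis)
      finally show ?thesis using i by simp
    qed
    have S_upd: "S (insert i I) (y(i := t)) = S I y + (t - x \<bullet> i) *\<^sub>R i" for y t
    proof -
      have "(\<Sum>b\<in>Basis - I. (x \<bullet> b) *\<^sub>R b) = (x \<bullet> i) *\<^sub>R i + (\<Sum>b\<in>Basis - insert i I. (x \<bullet> b) *\<^sub>R b)"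
        using sum.remove[of "Basis - I" i "\<lambda>b. (x \<bullet> b) *\<^sub>R b"] insert.hyps i
        by (simp add: Diff_insert[symmetric])
      moreover have "(\<Sum>b\<in>I. (y(i := t)) b *\<^sub>R b) = (\<Sum>b\<in>I. y b *\<^sub>R b)"
        using insert.hyps by (intro sum.cong) auto
      ultimately show ?thesis
        using insert.hyps by (simp add: S_def algebra_simps)
    qed
    have P_upd: "P (insert i I) (y(i := t)) = ker t (x \<bullet> i) * P I y" for y t
    proof -
      have "(\<Prod>b\<in>I. ker ((y(i := t)) b) (x \<bullet> b)) = (\<Prod>b\<in>I. ker (y b) (x \<bullet> b))"
        using insert.hyps by (intro prod.cong) auto
      then show ?thesis using insert.hyps by (simp add: P_def)
    qed
    have "(\<integral>y. f (S (insert i I) y) * P (insert i I) y \<partial>?M (insert i I)) =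
       (\<integral>y. (\<integral>t. f (S (insert i I) (y(i := t))) * P (insert i I) (y(i := t)) \<partial>lborel) \<partial>?M I)"
      by (rule product_integral_insert[OF insert.hyps fP_int[OF iI]])
    also have "\<dots> = (\<integral>y. G y * P I y \<partial>?M I)"
      unfolding S_upd P_upd G_def by (simp flip: integral_mult_left_zero add: mult_ac)
    finally have eq: "(\<integral>y. f (S (insert i I) y) * P (insert i I) y \<partial>?M (insert i I)) =
       (\<integral>y. G y * P I y \<partial>?M I)" .
    have Gf: "\<bar>G y - f (S I y)\<bar> \<le> e" for y
      using err[OF i, of "S I y"] by (simp add: G_def Si)
    have G_meas [measurable]: "G \<in> borel_measurable (?M I)"
    proof -
      note S_meas[OF insert.hyps(1), measurable]
      have "(\<lambda>(y, t). f (S I y + (t - x \<bullet> i) *\<^sub>R i) * ker t (x \<bullet> i)) \<in> borel_measurable (?M I \<Otimes>\<^sub>M lborel)"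
        by measurable
      then show ?thesis unfolding G_def[abs_def] by (rule lborel.borel_measurable_lebesgue_integral)
    qed
    have D_int: "integrable (?M I) (\<lambda>y. (G y - f (S I y)) * P I y)"
    proof (rule Bochner_Integration.integrable_bound)
      show "integrable (?M I) (\<lambda>y. e * P I y)" using P_int[OF insert.hyps(1)] by simp
      show "(\<lambda>y. (G y - f (S I y)) * P I y) \<in> borel_measurable (?M I)"
        using S_meas[OF insert.hyps(1)] P_int[OF insert.hyps(1)] by measurable
      show "AE y in ?M I. norm ((G y - f (S I y)) * P I y) \<le> norm (e * P I y)"
        using Gf e0 by (auto simp: abs_mult intro!: mult_right_mono)
    qed
    \<comment> \<open>Writing G as f plus its error separates the induction hypothesis from the new
      contribution e L^j.\<close>
    have "(\<integral>y. G y * P I y \<partial>?M I) =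
        (\<integral>y. (G y - f (S I y)) * P I y + f (S I y) * P I y \<partial>?M I)"
      by (simp add: algebra_simps)
    also have "\<dots> = (\<integral>y. (G y - f (S I y)) * P I y \<partial>?M I) + (\<integral>y. f (S I y) * P I y \<partial>?M I)"
      by (rule Bochner_Integration.integral_add[OF D_int fP_int[OF insert.hyps(1)]])
    finally have eq2: "(\<integral>y. G y * P I y \<partial>?M I) =
      (\<integral>y. (G y - f (S I y)) * P I y \<partial>?M I) + (\<integral>y. f (S I y) * P I y \<partial>?M I)" .
    have "\<bar>\<integral>y. (G y - f (S I y)) * P I y \<partial>?M I\<bar> \<le> (\<integral>y. \<bar>(G y - f (S I y)) * P I y\<bar> \<partial>?M I)"
      using integral_norm_bound by (simp flip: real_norm_def)
    also have "\<dots> \<le> (\<integral>y. e * \<bar>P I y\<bar> \<partial>?M I)"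
    proof (rule Bochner_Integration.integral_mono)
      show "\<bar>(G y - f (S I y)) * P I y\<bar> \<le> e * \<bar>P I y\<bar>" for y
        using Gf by (simp add: abs_mult mult_right_mono)
    qed (use D_int P_int[OF insert.hyps(1)] in auto)
    also have "\<dots> \<le> e * L ^ card I"
      using P_L1[OF insert.hyps(1)] e0 by (simp add: mult_left_mono)
    finally show ?case
      using insert.IH[OF IB] insert.hyps unfolding eq eq2 by (simp add: algebra_simps)
  qed
  have "(\<integral>y. f y * (\<Prod>b\<in>Basis. ker (y \<bullet> b) (x \<bullet> b)) \<partial>lborel) =
     (\<integral>y. f (S Basis y) * P Basis y \<partial>?M Basis)"
  proof -
    have "(\<integral>y. f y * (\<Prod>b\<in>Basis. ker (y \<bullet> b) (x \<bullet> b)) \<partial>lborel) =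
       (\<integral>y. f (\<Sum>b\<in>Basis. y b *\<^sub>R b) *
         (\<Prod>b\<in>Basis. ker ((\<Sum>b\<in>Basis. y b *\<^sub>R b) \<bullet> b) (x \<bullet> b)) \<partial>?M Basis)"
      by (subst lborel_eq, subst integral_distr) simp_all
    also have "\<dots> = (\<integral>y. f (S Basis y) * P Basis y \<partial>?M Basis)"
      by (simp add: S_def P_def)
    finally show ?thesis .
  qed
  then show ?thesis using main[OF finite_Basis subset_refl] by simp
qed

text \<open>The product argument uses kernels on the whole line with the indicator built in; this
  connects them to the gauge integrals of the one-variable estimates.\<close>

lemma lebesgue_integral_Icc_continuous:
  fixes g :: "real \<Rightarrow> real"
  assumes "continuous_on UNIV g"
  shows "integrable lborel (\<lambda>t. indicator {a..b} t * g t)"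
    and "(\<integral>t. indicator {a..b} t * g t \<partial>lborel) = integral {a..b} g"
proof -
  have *: "set_integrable lborel {a..b} g"
    by (rule borel_integrable_atLeastAtMost') (rule continuous_on_subset[OF assms], simp)
  then show "integrable lborel (\<lambda>t. indicator {a..b} t * g t)"
    by (simp add: set_integrable_def)
  show "(\<integral>t. indicator {a..b} t * g t \<partial>lborel) = integral {a..b} g"
    using set_borel_integral_eq_integral(2)[OF *] by (simp add: set_lebesgue_integral_def)
qed

section \<open>Permutations of coordinates\<close>

text \<open>The level sets {a \<le> m} and {a \<le> m o u} have the same size because u is a
  bijection, and both are initial segments of a linear order, so one contains the other and they
  coincide. The level sets determine the function.\<close>

lemma antitone_rearrangement_unique:
  fixes m :: "'n::{finite,linorder} \<Rightarrow> 'a::linorder"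
  assumes u: "u permutes UNIV" and m: "antimono m" and mu: "antimono (m \<circ> u)"
  shows "m \<circ> u = m"
proof
  fix i
  let ?A = "\<lambda>a. {j. a \<le> m j}" and ?B = "\<lambda>a. {j. a \<le> m (u j)}"
  have AB: "?A a = ?B a" for a
  proof -
    have "?A a = u ` ?B a"
      using permutes_surj[OF u] by (auto simp: image_iff dest: surjD)
    then have card: "card (?A a) = card (?B a)"
      using permutes_inj[OF u] by (simp add: card_image inj_on_subset)
    have "?A a \<subseteq> ?B a \<or> ?B a \<subseteq> ?A a"
    proof (rule ccontr)
      assume "\<not> ?thesis"
      then obtain p q where "a \<le> m p" "\<not> a \<le> m (u p)" "a \<le> m (u q)" "\<not> a \<le> m q" by auto
      then show False
        using antimonoD[OF m, of p q] antimonoD[OF m, of q p] antimonoD[OF mu, of p q]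
          antimonoD[OF mu, of q p] linear[of p q] by auto
    qed
    then show ?thesis using card by (metis card_subset_eq finite)
  qed
  show "(m \<circ> u) i = m i"
    using AB[of "m i"] AB[of "m (u i)"] by (auto intro: antisym)
qed

text \<open>The permutation sends the index of rank r to the r-th entry of the list of all indices
  sorted by decreasing m; p is the rank function.\<close>

lemma sorting_permutation_exists:
  fixes m :: "'n::{finite,linorder} \<Rightarrow> 'a::linorder"
  shows "\<exists>w. w permutes UNIV \<and> antimono (m \<circ> w)"
proof -
  define us where "us = sorted_list_of_set (UNIV :: 'n set)"
  define vs where "vs = rev (sort_key m us)"
  define n where "n = CARD('n)"
  have us: "distinct us" "set us = UNIV" "length us = n" "sorted_wrt (<) us"
    by (simp_all add: us_def n_def)
  have vs: "distinct vs" "set vs = UNIV" "length vs = n"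
    using us by (simp_all add: vs_def)
  have bu: "bij_betw ((!) us) {..<n} UNIV" and bv: "bij_betw ((!) vs) {..<n} UNIV"
    using us vs by (auto intro!: bij_betw_nth)
  define p where "p = the_inv_into {..<n} ((!) us)"
  have bp: "bij_betw p UNIV {..<n}"
    unfolding p_def by (rule bij_betw_the_inv_into[OF bu])
  have up: "us ! p i = i" "p i < n" for i
    using f_the_inv_into_f_bij_betw[OF bu, of i] bij_betwE[OF bp] by (auto simp: p_def)
  have p_mono: "p i \<le> p j" if "i \<le> j" for i j
  proof (rule ccontr)
    assume "\<not> p i \<le> p j"
    then have "us ! p j < us ! p i"
      using us(3) up(2) by (intro sorted_wrt_nth_less[OF us(4)]) auto
    then show False using that up by simp
  qed
  have sorted: "sorted_wrt (\<ge>) (map m vs)"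
    by (simp add: vs_def rev_map[symmetric] sorted_wrt_rev)
  have "antimono (m \<circ> ((!) vs \<circ> p))"
  proof (rule antimonoI)
    fix i j :: 'n assume "i \<le> j"
    then have "p i \<le> p j" by (rule p_mono)
    then show "(m \<circ> ((!) vs \<circ> p)) j \<le> (m \<circ> ((!) vs \<circ> p)) i"
      using sorted_wrt_nth_less[OF sorted, of "p i" "p j"] up vs
      by (cases "p i = p j") auto
  qed
  moreover have "((!) vs \<circ> p) permutes UNIV"
    by (rule bij_imp_permutes[OF bij_betw_trans[OF bp bv]]) simp
  ultimately show ?thesis by blast
qed

lemma perm_act_nth [simp]: "perm_act w x $ i = x $ w i"
  by (simp add: perm_act_def)

text \<open>Coordinates are read through the permutation, so the order of composition reverses: this
  is a right action, which is the source of the inverses below.\<close>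

lemma perm_act_comp: "perm_act w (perm_act v x) = perm_act (v \<circ> w) x"
  by (simp add: perm_act_def)

lemma perm_act_id [simp]: "perm_act id x = x" "perm_act (\<lambda>x. x) x = x"
  by (simp_all add: perm_act_def)

text \<open>The fibre is the coset of the stabilizer obtained by composing with \<open>w0\<close> on
  the right.\<close>

lemma card_perm_act_fibre:
  fixes m :: "int ^ 'n::finite"
  assumes w0: "w0 permutes UNIV"
  shows "card {w. w permutes UNIV \<and> perm_act w m = perm_act w0 m} = card (stab m)"
proof -
  have "bij_betw (\<lambda>u. u \<circ> w0) (stab m) {w. w permutes UNIV \<and> perm_act w m = perm_act w0 m}"
  proof (rule bij_betwI[where g = "\<lambda>w. w \<circ> inv w0"])
    show "(\<lambda>u. u \<circ> w0) \<in> stab m \<rightarrow> {w. w permutes UNIV \<and> perm_act w m = perm_act w0 m}"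
      using w0 by (auto simp: stab_def permutes_compose perm_act_comp[symmetric])
    show "(\<lambda>w. w \<circ> inv w0) \<in> {w. w permutes UNIV \<and> perm_act w m = perm_act w0 m} \<rightarrow> stab m"
      using w0 permutes_inv_o[OF w0]
      by (auto simp: stab_def permutes_compose permutes_inv perm_act_comp[symmetric])
         (simp add: perm_act_comp)
  qed (use permutes_inv_o[OF w0] in \<open>auto simp: o_assoc[symmetric]\<close>)
  then show ?thesis by (simp add: bij_betw_same_card)
qed

lemma sum_permutations_orbit:
  fixes m :: "int ^ 'n::finite" and g :: "int ^ 'n \<Rightarrow> real"
  shows "(\<Sum>w | w permutes UNIV. g (perm_act w m)) =
    real (card (stab m)) * (\<Sum>k\<in>(\<lambda>w. perm_act w m) ` {w. w permutes UNIV}. g k)"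
proof -
  let ?W = "{w. w permutes (UNIV :: 'n set)}"
  have "(\<Sum>w\<in>?W. g (perm_act w m)) =
     (\<Sum>k\<in>(\<lambda>w. perm_act w m) ` ?W. \<Sum>w | w \<in> ?W \<and> perm_act w m = k. g (perm_act w m))"
    by (rule sum.image_gen) (simp add: finite_permutations)
  also have "\<dots> = (\<Sum>k\<in>(\<lambda>w. perm_act w m) ` ?W. real (card (stab m)) * g k)"
    by (rule sum.cong) (auto simp: card_perm_act_fibre)
  finally show ?thesis by (simp add: sum_distrib_left)
qed

lemma stab_pos: "0 < card (stab (m :: int ^ 'n::finite))"
proof -
  have "id \<in> stab m" by (simp add: stab_def permutes_id)
  moreover have "finite (stab m)"
    by (rule finite_subset[OF _ finite_permutations[of UNIV]]) (auto simp: stab_def)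
  ultimately show ?thesis by (auto simp: card_gt_0_iff)
qed

lemma P_plus_altdef: "P_plus = {m :: int ^ 'n::{finite,linorder}. (\<forall>i. 0 \<le> m $ i) \<and> antimono (($) m)}"
  by (auto simp: P_plus_def antimono_def)

text \<open>The cube is stable under permutations, and each orbit in it contains exactly one
  decreasing tuple: existence by sorting, uniqueness by the rearrangement lemma. Summing over
  permutations counts every orbit point |G_m| times, which explains the factor |G_m|^(-1) in the
  coefficients.\<close>

lemma sum_cube_eq_sum_P_plus:
  fixes g :: "int ^ 'n::{finite,linorder} \<Rightarrow> real"
  shows "(\<Sum>k | \<forall>i. 0 \<le> k $ i \<and> k $ i \<le> int N. g k) =
    (\<Sum>m\<in>P_plus_upto N. inverse (real (card (stab m))) * (\<Sum>w | w permutes UNIV. g (perm_act w m)))"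
proof -
  let ?W = "{w. w permutes (UNIV :: 'n set)}"
  let ?orb = "\<lambda>m :: int ^ 'n::{finite,linorder}. (\<lambda>w. perm_act w m) ` ?W"
  have un: "{k :: int ^ 'n::{finite,linorder}. \<forall>i. 0 \<le> k $ i \<and> k $ i \<le> int N} = (\<Union>m\<in>P_plus_upto N. ?orb m)"
  proof (intro equalityI subsetI)
    fix k :: "int ^ 'n::{finite,linorder}"
    assume k: "k \<in> {k. \<forall>i. 0 \<le> k $ i \<and> k $ i \<le> int N}"
    obtain w where w: "w permutes UNIV" "antimono (($) k \<circ> w)"
      using sorting_permutation_exists[of "($) k"] by blast
    then have "perm_act w k \<in> P_plus_upto N"
      using k by (auto simp: P_plus_upto_def P_plus_altdef antimono_def)
    moreover have "k = perm_act (inv w) (perm_act w k)"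
      using permutes_inv_o[OF w(1)] by (simp add: perm_act_comp)
    ultimately show "k \<in> (\<Union>m\<in>P_plus_upto N. ?orb m)"
      using permutes_inv[OF w(1)] by blast
  qed (auto simp: P_plus_upto_def P_plus_def)
  have disj: "?orb m \<inter> ?orb m' = {}" if "m \<in> P_plus_upto N" "m' \<in> P_plus_upto N" "m \<noteq> m'" for m m'
  proof (rule ccontr)
    assume "?orb m \<inter> ?orb m' \<noteq> {}"
    then obtain w v where wv: "w permutes UNIV" "v permutes UNIV" "perm_act w m = perm_act v m'" by auto
    have "m' = perm_act (inv v) (perm_act v m')"
      using permutes_inv_o[OF wv(2)] by (simp add: perm_act_comp)
    also have "\<dots> = perm_act (w \<circ> inv v) m" by (simp add: wv(3)[symmetric] perm_act_comp)
    finally have m': "m' = perm_act (w \<circ> inv v) m" .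
    have "($) m' = ($) m \<circ> (w \<circ> inv v)" by (subst m') auto
    moreover have "w \<circ> inv v permutes UNIV"
      by (intro permutes_compose permutes_inv wv)
    ultimately have "($) m' = ($) m"
      using antitone_rearrangement_unique[of "w \<circ> inv v" "($) m"] that(1,2)
      by (auto simp: P_plus_upto_def P_plus_altdef)
    then show False using that(3) by (simp add: vec_nth_inject)
  qed
  have "(\<Sum>k | \<forall>i. 0 \<le> k $ i \<and> k $ i \<le> int N. g k) = (\<Sum>m\<in>P_plus_upto N. \<Sum>k\<in>?orb m. g k)"
    unfolding un using disj by (intro sum.UNION_disjoint) (auto simp: finite_P_plus_upto finite_permutations)
  also have "\<dots> = (\<Sum>m\<in>P_plus_upto N. inverse (real (card (stab m))) * (\<Sum>w | w permutes UNIV. g (perm_act w m)))"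
  proof (rule sum.cong[OF refl])
    fix m :: "int ^ 'n::{finite,linorder}"
    show "(\<Sum>k\<in>?orb m. g k) = inverse (real (card (stab m))) * (\<Sum>w | w permutes UNIV. g (perm_act w m))"
      using stab_pos[of m] unfolding sum_permutations_orbit by (auto simp: field_simps)
  qed
  finally show ?thesis .
qed

section \<open>Invariance of Lebesgue measure and the tiling of the half cube\<close>

lemma linear_perm_act: "linear (perm_act w :: real ^ 'n \<Rightarrow> real ^ 'n::finite)"
  by (rule linearI) (simp_all add: perm_act_def vec_eq_iff)

lemma perm_act_measurable [measurable]:
  "(perm_act w :: real ^ 'n \<Rightarrow> real ^ 'n::finite) \<in> borel_measurable borel"
  by (intro borel_measurable_continuous_onI linear_continuous_on linear_conv_bounded_linear[THEN iffD1] linear_perm_act)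

lemma prod_Basis_vec:
  fixes \<phi> :: "real ^ 'n::finite \<Rightarrow> 'a::comm_monoid_mult"
  shows "(\<Prod>b\<in>Basis. \<phi> b) = (\<Prod>i\<in>UNIV. \<phi> (axis i 1))"
  by (simp add: Basis_vec_def UNION_singleton_eq_range prod.reindex inj_on_def axis_eq_axis)

text \<open>Lebesgue measure is determined by its values on boxes, and the preimage of a box is the
  box with permuted sides.\<close>

lemma lborel_distr_perm_act:
  assumes w: "w permutes (UNIV :: 'n::finite set)"
  shows "distr lborel borel (perm_act w :: real ^ 'n \<Rightarrow> real ^ 'n) = lborel"
proof (rule lborel_eqI[symmetric])
  fix l u :: "real ^ 'n"
  assume le: "\<And>b. b \<in> Basis \<Longrightarrow> l \<bullet> b \<le> u \<bullet> b"
  then have lu: "l $ i \<le> u $ i" for i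
    using le[of "axis i 1"] by (simp add: axis_in_Basis_iff inner_axis)
  have wi: "w (inv w i) = i" "inv w (w i) = i" for i
    using permutes_inverses[OF w] by auto
  have pre: "perm_act w -` box l u = box (perm_act (inv w) l) (perm_act (inv w) u)"
    by (auto simp: mem_box_cart) (metis wi)+
  have "emeasure (distr lborel borel (perm_act w)) (box l u) =
      emeasure lborel (box (perm_act (inv w) l) (perm_act (inv w) u))"
    by (simp add: emeasure_distr pre)
  also have "\<dots> = (\<Prod>b\<in>Basis. (perm_act (inv w) u - perm_act (inv w) l) \<bullet> b)"
    by (rule emeasure_lborel_box) (auto simp: Basis_vec_def inner_axis lu)
  also have "(\<Prod>b\<in>Basis. (perm_act (inv w) u - perm_act (inv w) l) \<bullet> b) =
      (\<Prod>i\<in>UNIV. u $ inv w i - l $ inv w i)"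
    by (simp add: prod_Basis_vec inner_axis)
  also have "\<dots> = (\<Prod>i\<in>UNIV. u $ i - l $ i)"
    using prod.permute[OF permutes_inv[OF w], of "\<lambda>i. u $ i - l $ i"] by (simp add: o_def)
  also have "\<dots> = (\<Prod>b\<in>Basis. (u - l) \<bullet> b)"
    by (simp add: prod_Basis_vec inner_axis)
  finally show "emeasure (distr lborel borel (perm_act w)) (box l u) = (\<Prod>b\<in>Basis. (u - l) \<bullet> b)" .
qed simp

lemma lebesgue_integral_perm_act:
  fixes g :: "real ^ 'n::finite \<Rightarrow> real"
  assumes w: "w permutes (UNIV :: 'n::finite set)" and [measurable]: "g \<in> borel_measurable borel"
  shows "(\<integral>x. g (perm_act w x) \<partial>lborel) = (\<integral>x. g x \<partial>lborel)"
proof -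
  have "(\<integral>x. g x \<partial>lborel) = (\<integral>x. g x \<partial>distr lborel borel (perm_act w))"
    by (simp add: lborel_distr_perm_act[OF w])
  also have "\<dots> = (\<integral>x. g (perm_act w x) \<partial>lborel)"
    by (subst integral_distr) simp_all
  finally show ?thesis by simp
qed

definition half_cube :: "(real ^ 'n) set" where
  "half_cube = {x. \<forall>i. 0 \<le> x $ i \<and> x $ i \<le> 1 / 2}"

lemma F_closed_altdef:
  "F_closed = {x :: real ^ 'n::{finite,linorder}. x \<in> half_cube \<and> antimono (($) x)}"
  by (auto simp: F_closed_def half_cube_def antimono_def)

lemma closed_F_closed: "closed (F_closed :: (real ^ 'n::{finite,linorder}) set)"
  unfolding F_closed_def
  by (intro closed_Collect_conj closed_Collect_all closed_Collect_imp closed_Collect_le open_Collect_const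
      continuous_intros)

lemma half_cube_eq: "half_cube = cbox (0 :: real ^ 'n) (\<chi> i. 1 / 2)"
  by (auto simp: half_cube_def mem_box_cart)

text \<open>The permuted copies of \<open>F_closed\<close> overlap only where two coordinates
  coincide, that is, on finitely many hyperplanes.\<close>

lemma AE_inj_vec_nth: "AE x in lborel. inj (($) (x :: real ^ 'n::finite))"
proof -
  have "AE x in lborel. x $ i \<noteq> (x :: real ^ 'n) $ j" if "i \<noteq> j" for i j
  proof -
    have "(axis i 1 - axis j 1 :: real ^ 'n) \<noteq> 0"
      using that by (simp add: axis_eq_axis)
    then have "negligible {x :: real ^ 'n. (axis i 1 - axis j 1) \<bullet> x = 0}"
      by (intro negligible_hyperplane) auto
    then have "negligible {x :: real ^ 'n. x $ i = x $ j}"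
      by (simp add: inner_diff_left inner_axis')
    moreover have "{x :: real ^ 'n. x $ i = x $ j} \<in> sets lborel"
      unfolding sets_lborel by (intro borel_closed closed_Collect_eq continuous_intros)
    ultimately have "{x :: real ^ 'n. x $ i = x $ j} \<in> null_sets lborel"
      by (simp add: negligible_iff_null_sets null_sets_completion_iff)
    then show ?thesis by (rule AE_I') auto
  qed
  then have "AE x in lborel. \<forall>i. \<forall>j. i \<noteq> j \<longrightarrow> x $ i \<noteq> (x :: real ^ 'n) $ j"
    by (auto simp: AE_all_countable)
  then show ?thesis by eventually_elim (auto simp: inj_on_def)
qed

text \<open>A point with distinct coordinates is sorted by exactly one permutation, so exactly one
  summand is 1 on the half cube.\<close>

lemma sum_indicator_F_closed:
  fixes x :: "real ^ 'n::{finite,linorder}"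
  assumes inj: "inj (($) x)"
  shows "(\<Sum>w | w permutes UNIV. indicator F_closed (perm_act w x) :: real) = indicator half_cube x"
proof -
  obtain w where w: "w permutes UNIV" "antimono (($) x \<circ> w)"
    using sorting_permutation_exists[of "($) x"] by blast
  have uniq: "v = w" if v: "v permutes UNIV" "antimono (($) x \<circ> v)" for v
  proof -
    have u: "inv w \<circ> v permutes UNIV" by (intro permutes_compose permutes_inv w v)
    have e: "($) x \<circ> w \<circ> (inv w \<circ> v) = ($) x \<circ> v"
      using permutes_inverses[OF w(1)] by auto
    have "($) x \<circ> v = ($) x \<circ> w"
      using antitone_rearrangement_unique[OF u w(2)] v(2) unfolding e by simp
    then show ?thesis using inj by (auto simp: fun_eq_iff inj_def)
  qed
  have hc: "perm_act v x \<in> half_cube \<longleftrightarrow> x \<in> half_cube" if "v permutes UNIV" for v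
    unfolding half_cube_def using permutes_inverses[OF that] by simp metis
  have "(\<Sum>v | v permutes UNIV. indicator F_closed (perm_act v x) :: real) =
      (\<Sum>v | v permutes UNIV. if v = w then indicator half_cube x else 0)"
  proof (rule sum.cong[OF refl])
    fix v assume "v \<in> {v. v permutes (UNIV :: 'n set)}"
    then have v: "v permutes UNIV" by simp
    have "($) (perm_act v x) = ($) x \<circ> v" by auto
    then have "perm_act v x \<in> F_closed \<longleftrightarrow> x \<in> half_cube \<and> v = w"
      using hc[OF v] uniq[OF v] w by (auto simp: F_closed_altdef)
    then show "(indicator F_closed (perm_act v x) :: real) = (if v = w then indicator half_cube x else 0)"
      by (auto simp: indicator_def)
  qed
  also have "\<dots> = indicator half_cube x"
    using w(1) by (simp add: finite_permutations)
  finally show ?thesis .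
qed

section \<open>The expansion and the Plancherel formula\<close>

text \<open>Every finite subset of A lies in some S N, so for nonnegative terms the limit bounds all
  finite sums and the family is summable. This turns the limit over cubes into the unordered
  Plancherel sum.\<close>

lemma has_sum_exhausting:
  fixes g :: "'a \<Rightarrow> real"
  assumes nn: "\<And>x. x \<in> A \<Longrightarrow> 0 \<le> g x" and S: "incseq S" "\<And>N. finite (S N)" "(\<Union>N::nat. S N) = A"
    and lim: "(\<lambda>N. \<Sum>x\<in>S N. g x) \<longlonglongrightarrow> l"
  shows "(g has_sum l) A"
proof -
  have cover: "\<exists>N. X \<subseteq> S N" if "finite X" "X \<subseteq> A" for X
    using that
  proof (induction rule: finite_induct)
    case (insert x X)
    then obtain N1 N2 where "X \<subseteq> S N1" "x \<in> S N2" using S(3) by blast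
    then have "insert x X \<subseteq> S (max N1 N2)"
      using incseqD[OF S(1), of N1 "max N1 N2"] incseqD[OF S(1), of N2 "max N1 N2"] by auto
    then show ?case by blast
  qed simp
  have SA: "S N \<subseteq> A" for N using S(3) by blast
  have "incseq (\<lambda>N. \<Sum>x\<in>S N. g x)"
  proof (intro incseq_SucI sum_mono2)
    fix N x assume "x \<in> S (Suc N) - S N"
    then show "0 \<le> g x" using SA nn by blast
  qed (use S in \<open>auto dest: incseq_SucD\<close>)
  then have le: "(\<Sum>x\<in>S N. g x) \<le> l" for N using lim by (rule incseq_le)
  have "sum g X \<le> l" if X: "finite X" "X \<subseteq> A" for X
  proof -
    obtain N where N: "X \<subseteq> S N" using cover[OF X] by blast
    have "sum g X \<le> sum g (S N)"
      using S(2) N SA[of N] nn by (intro sum_mono2) auto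
    then show ?thesis using le[of N] by simp
  qed
  then have "g summable_on A"
    using nn by (intro nonneg_bounded_partial_sums_imp_summable_on[of A g l])
      (auto simp: eventually_finite_subsets_at_top)
  then have *: "(g has_sum infsum g A) A" by (rule has_sum_infsum)
  \<comment> \<open>The exhaustion is cofinal among the finite subsets, so the limit along it is the
    unordered sum.\<close>
  have "filterlim S (finite_subsets_at_top A) sequentially"
    unfolding filterlim_finite_subsets_at_top
  proof (intro allI impI)
    fix X assume "finite X \<and> X \<subseteq> A"
    then obtain N where "X \<subseteq> S N" using cover by blast
    then show "\<forall>\<^sub>F N in sequentially. finite (S N) \<and> X \<subseteq> S N \<and> S N \<subseteq> A"
      using S(2) SA incseqD[OF S(1)] unfolding eventually_sequentially by (meson order_trans)
  qed
  then have "(\<lambda>N. \<Sum>x\<in>S N. g x) \<longlonglongrightarrow> infsum g A"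
    using * unfolding has_sum_def by (rule filterlim_compose[rotated])
  then show ?thesis using * lim LIMSEQ_unique by metis
qed

lemma lattice_periodic_bounded:
  fixes f :: "real ^ 'n::finite \<Rightarrow> real"
  assumes cont: "continuous_on UNIV f" and per: "\<And>x r. f (x + int_vec r) = f x"
  obtains B where "\<And>x. \<bar>f x\<bar> \<le> B"
proof -
  have "compact (f ` cbox 0 (\<chi> i. 1))"
    by (intro compact_continuous_image continuous_on_subset[OF cont]) auto
  then obtain B where B: "\<And>x. x \<in> cbox 0 (\<chi> i. 1) \<Longrightarrow> \<bar>f x\<bar> \<le> B"
    by (metis compact_imp_bounded bounded_iff imageI real_norm_def)
  have "\<bar>f x\<bar> \<le> B" for x
  proof -
    let ?y = "\<chi> i. frac (x $ i)"
    have "x = ?y + int_vec (\<chi> i. \<lfloor>x $ i\<rfloor>)"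
      by (simp add: vec_eq_iff int_vec_def frac_def)
    then have "f x = f ?y" by (metis per)
    moreover have "?y \<in> cbox 0 (\<chi> i. 1)"
      by (auto simp: mem_box_cart frac_ge_0 less_imp_le[OF frac_lt_1])
    ultimately show ?thesis using B by simp
  qed
  then show ?thesis using that by blast
qed

section \<open>Unfolding the partial sum into a product kernel\<close>

lemma sin_plus_perm_act:
  assumes w: "w permutes (UNIV :: 'n::finite set)"
  shows "sin_plus (perm_act w m) x = sin_plus (m :: int ^ 'n) x"
  unfolding sin_plus_def
  by (subst (2) setum_permutations_compose_left[OF w]) simp

lemma continuous_on_sin_plus [continuous_intros]: "continuous_on S (sin_plus m)"
  unfolding sin_plus_def[abs_def] by (intro continuous_intros)

lemma prod_sine_kernel:
  fixes y z :: "real ^ 'n::finite"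
  shows "(\<Prod>j\<in>UNIV. sine_kernel N (y $ j) (z $ j)) =
    4 ^ CARD('n) * (\<Sum>k :: int ^ 'n | \<forall>i. 0 \<le> k $ i \<and> k $ i \<le> int N.
      (\<Prod>j\<in>UNIV. sin (2 * pi * real_of_int (k $ j) * y $ j)) *
      (\<Prod>j\<in>UNIV. sin (2 * pi * real_of_int (k $ j) * z $ j)))"
proof -
  let ?s = "\<lambda>j p. sin (2 * pi * real p * y $ j) * sin (2 * pi * real p * z $ j)"
  have "(\<Prod>j\<in>UNIV. sine_kernel N (y $ j) (z $ j)) = 4 ^ CARD('n) * (\<Prod>j\<in>UNIV. \<Sum>p\<le>N. ?s j p)"
    by (simp add: sine_kernel_def prod.distrib)
  also have "(\<Prod>j\<in>UNIV. \<Sum>p\<le>N. ?s j p) = (\<Sum>g\<in>UNIV \<rightarrow>\<^sub>E {..N}. \<Prod>j\<in>UNIV. ?s j (g j))"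
    by (rule prod_sum_PiE) auto
  also have "\<dots> = (\<Sum>k :: int ^ 'n | \<forall>i. 0 \<le> k $ i \<and> k $ i \<le> int N.
      (\<Prod>j\<in>UNIV. sin (2 * pi * real_of_int (k $ j) * y $ j)) *
      (\<Prod>j\<in>UNIV. sin (2 * pi * real_of_int (k $ j) * z $ j)))"
    by (rule sum.reindex_bij_witness[where i = "\<lambda>k i. nat (k $ i)" and j = "\<lambda>g. \<chi> i. int (g i)"])
       (auto simp: vec_eq_iff PiE_iff prod.distrib nat_le_iff)
  finally show ?thesis .
qed

text \<open>Here the index side is unfolded: the weighted sum over decreasing tuples becomes a sum
  over the whole cube, which factors into one-variable kernels. One sum over permutations remains,
  acting on y; it is absorbed later by the tiling.\<close>

lemma sum_sin_plus_products:
  fixes x y :: "real ^ 'n::{finite,linorder}"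
  shows "2 ^ (2 * CARD('n)) * (\<Sum>m\<in>P_plus_upto N. inverse (real (card (stab m))) * (sin_plus m y * sin_plus m x)) =
    (\<Sum>w | w permutes UNIV. \<Prod>j\<in>UNIV. sine_kernel N (perm_act w y $ j) (x $ j))"
proof -
  define e :: "int ^ 'n::{finite,linorder} \<Rightarrow> real ^ 'n::{finite,linorder} \<Rightarrow> real"
    where "e k z = (\<Prod>j\<in>UNIV. sin (2 * pi * real_of_int (k $ j) * z $ j))" for k z
  let ?C = "{k :: int ^ 'n::{finite,linorder}. \<forall>i. 0 \<le> k $ i \<and> k $ i \<le> int N}"
  have sp: "sin_plus m z = (\<Sum>w | w permutes UNIV. e (perm_act w m) z)" for m z
    by (simp add: sin_plus_def e_def)
  \<comment> \<open>Reindexing the product by w moves the permutation from the frequencies to the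
    variable, at the price of an inverse that disappears after summing over the group.\<close>
  have tr: "e (perm_act (inv w) k) z = e k (perm_act w z)" if w: "w permutes UNIV" for w k z
    using prod.permute[OF w, of "\<lambda>j. sin (2 * pi * real_of_int (k $ inv w j) * z $ j)"]
    by (simp add: e_def o_def permutes_inverses[OF w])
  have sp': "sin_plus k z = (\<Sum>w | w permutes UNIV. e k (perm_act w z))" for k z
    unfolding sp by (subst sum_permutations_inverse) (auto intro!: sum.cong simp: tr)
  \<comment> \<open>Only the factor in x is expanded over the orbit; the factor in y is constant on
    it. Expanding both would give a double sum over permutations.\<close>
  have "(\<Sum>m\<in>P_plus_upto N. inverse (real (card (stab m))) * (sin_plus m y * sin_plus m x)) =
     (\<Sum>m\<in>P_plus_upto N. inverse (real (card (stab m))) *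
        (\<Sum>w | w permutes UNIV. sin_plus (perm_act w m) y * e (perm_act w m) x))"
  proof (rule sum.cong[OF refl])
    fix m :: "int ^ 'n::{finite,linorder}"
    have "sin_plus m y * sin_plus m x = (\<Sum>w | w permutes UNIV. sin_plus m y * e (perm_act w m) x)"
      by (simp add: sp[of m x] sum_distrib_left)
    also have "\<dots> = (\<Sum>w | w permutes UNIV. sin_plus (perm_act w m) y * e (perm_act w m) x)"
      by (rule sum.cong) (auto simp: sin_plus_perm_act)
    finally show "inverse (real (card (stab m))) * (sin_plus m y * sin_plus m x) =
      inverse (real (card (stab m))) * (\<Sum>w | w permutes UNIV. sin_plus (perm_act w m) y * e (perm_act w m) x)"
      by simp
  qed
  also have "\<dots> = (\<Sum>k\<in>?C. sin_plus k y * e k x)"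
    by (rule sum_cube_eq_sum_P_plus[symmetric])
  also have "\<dots> = (\<Sum>w | w permutes UNIV. \<Sum>k\<in>?C. e k (perm_act w y) * e k x)"
    unfolding sp' sum_distrib_right by (rule sum.swap)
  finally have "2 ^ (2 * CARD('n)) * (\<Sum>m\<in>P_plus_upto N. inverse (real (card (stab m))) * (sin_plus m y * sin_plus m x)) =
     (\<Sum>w | w permutes UNIV. 4 ^ CARD('n) * (\<Sum>k\<in>?C. e k (perm_act w y) * e k x))"
    by (simp add: power_mult sum_distrib_left)
  then show ?thesis by (simp only: prod_sine_kernel e_def)
qed

lemma compact_F_closed: "compact (F_closed :: (real ^ 'n::{finite,linorder}) set)"
proof -
  have "F_closed \<subseteq> cbox (0 :: real ^ 'n::{finite,linorder}) (\<chi> i. 1 / 2)"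
    by (auto simp: F_closed_altdef half_cube_eq)
  then show ?thesis
    using closed_F_closed bounded_subset[OF bounded_cbox] by (auto simp: compact_eq_bounded_closed)
qed

lemma integrable_F_closed:
  fixes g :: "real ^ 'n::{finite,linorder} \<Rightarrow> real"
  assumes "continuous_on UNIV g"
  shows "set_integrable lborel F_closed g"
  unfolding set_integrable_def
  by (rule borel_integrable_compact[OF compact_F_closed continuous_on_subset[OF assms]]) simp

text \<open>Here the space side is unfolded: by invariance of f a change of variables moves each
  permutation from the kernel to \<open>F_closed\<close>, and the permuted copies make up the half
  cube, where the integrand is f times a product.\<close>

lemma partial_sum_eq_integral:
  fixes f :: "real ^ 'n::{finite,linorder} \<Rightarrow> real"
  assumes cont: "continuous_on UNIV f" and sym: "\<And>x w. w permutes UNIV \<Longrightarrow> f (perm_act w x) = f x"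
  shows "(\<Sum>m\<in>P_plus_upto N. sin_plus_coeff f m * sin_plus m x) =
    (\<integral>y. f y * (\<Prod>b\<in>Basis. indicator {0..1 / 2} (y \<bullet> b) * sine_kernel N (y \<bullet> b) (x \<bullet> b)) \<partial>lborel)"
proof -
  let ?W = "{w. w permutes (UNIV :: 'n set)}"
  define K where "K y = (\<Prod>j\<in>UNIV. sine_kernel N (y $ j) (x $ j))" for y :: "real ^ 'n::{finite,linorder}"
  have contK: "continuous_on UNIV K"
    unfolding K_def[abs_def] sine_kernel_eq by (intro continuous_intros)
  have [measurable]: "f \<in> borel_measurable borel" "K \<in> borel_measurable borel"
    using cont contK by (auto intro: borel_measurable_continuous_onI)
  have F_borel [measurable]: "(F_closed :: (real ^ 'n::{finite,linorder}) set) \<in> sets borel"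
    using closed_F_closed by (rule borel_closed)
  have cperm: "continuous_on UNIV (perm_act w :: real ^ 'n::{finite,linorder} \<Rightarrow> _)" for w
    unfolding perm_act_def[abs_def] by (intro continuous_intros)
  have intF: "integrable lborel (\<lambda>y. indicator F_closed y * g y)" if "continuous_on UNIV g" for g :: "real ^ 'n::{finite,linorder} \<Rightarrow> real"
    using integrable_F_closed[OF that] by (simp add: set_integrable_def)
  have "(\<Sum>m\<in>P_plus_upto N. sin_plus_coeff f m * sin_plus m x) =
     (\<Sum>m\<in>P_plus_upto N. \<integral>y. indicator F_closed y * (2 ^ (2 * CARD('n)) *
        (f y * (inverse (real (card (stab m))) * (sin_plus m y * sin_plus m x)))) \<partial>lborel)"
    unfolding sin_plus_coeff_def set_lebesgue_integral_def
    by (rule sum.cong) (simp_all flip: integral_mult_right_zero integral_mult_left_zero add: mult_ac)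
  also have "\<dots> = (\<integral>y. (\<Sum>m\<in>P_plus_upto N. indicator F_closed y * (2 ^ (2 * CARD('n)) *
        (f y * (inverse (real (card (stab m))) * (sin_plus m y * sin_plus m x))))) \<partial>lborel)"
    by (rule Bochner_Integration.integral_sum[symmetric])
       (intro intF continuous_intros cont)
  also have "\<dots> = (\<integral>y. (\<Sum>w\<in>?W. indicator F_closed y * (f y * K (perm_act w y))) \<partial>lborel)"
  proof (rule Bochner_Integration.integral_cong[OF refl])
    fix y :: "real ^ 'n::{finite,linorder}"
    have "(\<Sum>m\<in>P_plus_upto N. indicator F_closed y * (2 ^ (2 * CARD('n)) *
        (f y * (inverse (real (card (stab m))) * (sin_plus m y * sin_plus m x))))) =
      indicator F_closed y * (f y * (2 ^ (2 * CARD('n)) *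
        (\<Sum>m\<in>P_plus_upto N. inverse (real (card (stab m))) * (sin_plus m y * sin_plus m x))))"
      by (simp add: sum_distrib_left mult_ac)
    also have "\<dots> = (\<Sum>w\<in>?W. indicator F_closed y * (f y * K (perm_act w y)))"
      unfolding sum_sin_plus_products by (simp add: K_def sum_distrib_left)
    finally show "(\<Sum>m\<in>P_plus_upto N. indicator F_closed y * (2 ^ (2 * CARD('n)) *
        (f y * (inverse (real (card (stab m))) * (sin_plus m y * sin_plus m x))))) =
      (\<Sum>w\<in>?W. indicator F_closed y * (f y * K (perm_act w y)))" .
  qed
  also have "\<dots> = (\<Sum>w\<in>?W. \<integral>y. indicator F_closed y * (f y * K (perm_act w y)) \<partial>lborel)"
    by (rule Bochner_Integration.integral_sum)
       (intro intF continuous_intros cont continuous_on_compose2[OF contK cperm], simp)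
  \<comment> \<open>The sum on the right is first reindexed by inversion; then the substitution of
    \<open>perm_act w y\<close> for y cancels the inverse on the indicator and leaves f
    unchanged.\<close>
  also have "\<dots> = (\<Sum>w\<in>?W. \<integral>y. indicator F_closed (perm_act w y) * (f y * K y) \<partial>lborel)"
  proof (subst (2) sum_permutations_inverse, rule sum.cong[OF refl])
    fix w assume "w \<in> ?W"
    then have w: "w permutes UNIV" by simp
    have "(\<integral>y. indicator F_closed (perm_act (inv w) y) * (f y * K y) \<partial>lborel) =
      (\<integral>y. indicator F_closed (perm_act (inv w) (perm_act w y)) * (f (perm_act w y) * K (perm_act w y)) \<partial>lborel)"
      by (rule lebesgue_integral_perm_act[OF w, symmetric]) measurable
    also have "\<dots> = (\<integral>y. indicator F_closed y * (f y * K (perm_act w y)) \<partial>lborel)"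
      using permutes_inv_o[OF w] by (simp add: perm_act_comp sym[OF w])
    finally show "(\<integral>y. indicator F_closed y * (f y * K (perm_act w y)) \<partial>lborel) =
      (\<integral>y. indicator F_closed (perm_act (inv w) y) * (f y * K y) \<partial>lborel)" by simp
  qed
  also have "\<dots> = (\<integral>y. (\<Sum>w\<in>?W. indicator F_closed (perm_act w y) * (f y * K y)) \<partial>lborel)"
  proof (rule Bochner_Integration.integral_sum[symmetric])
    fix w assume "w \<in> ?W"
    then have w: "w permutes UNIV" by simp
    have half: "integrable lborel (\<lambda>y. indicator half_cube y *\<^sub>R (f y * K y))"
      unfolding half_cube_eq
      by (rule borel_integrable_compact) (auto intro!: continuous_intros continuous_on_subset[OF cont] continuous_on_subset[OF contK])
    show "integrable lborel (\<lambda>y. indicator F_closed (perm_act w y) * (f y * K y))"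
    proof (rule Bochner_Integration.integrable_bound[OF half])
      have "y \<in> half_cube" if "perm_act w y \<in> F_closed" for y
        using that permutes_inverses[OF w] by (simp add: F_closed_altdef half_cube_def) metis
      then show "AE y in lborel. norm (indicator F_closed (perm_act w y) * (f y * K y)) \<le>
          norm (indicator half_cube y *\<^sub>R (f y * K y))"
        by (auto simp: indicator_def)
    qed measurable
  qed
  \<comment> \<open>The indicators add up to that of the half cube off the diagonal hyperplanes,
    hence only almost everywhere.\<close>
  also have "\<dots> = (\<integral>y. indicator half_cube y * (f y * K y) \<partial>lborel)"
  proof (rule Bochner_Integration.integral_cong_AE)
    show "AE y in lborel. (\<Sum>w\<in>?W. indicator F_closed (perm_act w y) * (f y * K y)) =
        indicator half_cube y * (f y * K y)"
      using AE_inj_vec_nth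
      by eventually_elim (simp add: sum_distrib_right[symmetric] sum_indicator_F_closed)
    show "(\<lambda>y. \<Sum>w\<in>?W. indicator F_closed (perm_act w y) * (f y * K y)) \<in> borel_measurable lborel"
      by measurable
    show "(\<lambda>y. indicator half_cube y * (f y * K y)) \<in> borel_measurable lborel"
      unfolding half_cube_eq by measurable
  qed
  also have "\<dots> = (\<integral>y. f y * (\<Prod>b\<in>Basis. indicator {0..1 / 2} (y \<bullet> b) * sine_kernel N (y \<bullet> b) (x \<bullet> b)) \<partial>lborel)"
  proof (rule Bochner_Integration.integral_cong[OF refl])
    fix y :: "real ^ 'n::{finite,linorder}"
    have "(\<Prod>j\<in>UNIV. indicator {0..1 / 2} (y $ j)) = (indicator half_cube y :: real)"
      by (auto simp: indicator_def half_cube_def prod_zero_iff)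
    then show "indicator half_cube y * (f y * K y) =
        f y * (\<Prod>b\<in>Basis. indicator {0..1 / 2} (y \<bullet> b) * sine_kernel N (y \<bullet> b) (x \<bullet> b))"
      by (simp add: prod_Basis_vec inner_axis prod.distrib K_def)
  qed
  finally show ?thesis .
qed

section \<open>Uniform convergence and the Plancherel formula\<close>

lemma sine_kernel_error_tendsto_0:
  "(\<lambda>N. M / sqrt (real N) * (\<Sum>j<n. (2 * ln (4 * real N + 3)) ^ j)) \<longlonglongrightarrow> 0"
proof -
  have "(\<lambda>N. (2 * ln (4 * real N + 3)) ^ j / sqrt (real N)) \<longlonglongrightarrow> 0" for j :: nat
    by real_asymp
  then have "(\<lambda>N. \<Sum>j<n. M * ((2 * ln (4 * real N + 3)) ^ j / sqrt (real N))) \<longlonglongrightarrow> (\<Sum>j<n. M * 0)"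
    by (intro tendsto_sum tendsto_mult_left)
  then show ?thesis by (simp add: sum_distrib_left)
qed

lemma sine_partial_sum_uniform_error:
  fixes f :: "real ^ 'n::{finite,linorder} \<Rightarrow> real"
  assumes cont: "continuous_on UNIV f"
    and diff: "continuous_partial_derivs f"
    and per: "\<And>x w r. w permutes (UNIV :: 'n set) \<Longrightarrow> f (perm_act w x + int_vec r) = f x"
    and odd: "\<And>x i. f (sign_flip i x) = - f x"
  obtains M where "\<And>N x. N > 0 \<Longrightarrow>
    \<bar>(\<Sum>m\<in>P_plus_upto N. sin_plus_coeff f m * sin_plus m x) - f x\<bar> \<le>
      M / sqrt (real N) * (\<Sum>j<CARD('n). (2 * ln (4 * real N + 3)) ^ j)"
proof -
  have sym: "f (perm_act w x) = f x" if "w permutes UNIV" for w x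
    using per[OF that, of x 0] by (simp add: int_vec_def vec_eq_iff zero_vec_def[symmetric])
  have per': "f (x + int_vec r) = f x" for x r
    using per[OF permutes_id, of x r] by simp
  obtain B where B: "\<And>x. \<bar>f x\<bar> \<le> B"
    using lattice_periodic_bounded[OF cont per'] by blast
  obtain g where g_cont: "\<And>i. continuous_on UNIV (g i)"
    and g_der: "\<And>i x. ((\<lambda>t. f (x + t *\<^sub>R axis i 1)) has_real_derivative g i x) (at 0)"
    using diff unfolding continuous_partial_derivs_def by metis
  \<comment> \<open>The partial derivatives inherit the periods of f, so compactness of the unit
    cube bounds them as well.\<close>
  have g_per: "g i (x + int_vec r) = g i x" for i x r
  proof (rule DERIV_unique)
    show "((\<lambda>t. f (x + t *\<^sub>R axis i 1)) has_real_derivative g i x) (at 0)" by (rule g_der)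
    have "f (x + int_vec r + t *\<^sub>R axis i 1) = f (x + t *\<^sub>R axis i 1)" for t
      using per'[of "x + t *\<^sub>R axis i 1" r] by (simp add: add_ac)
    then show "((\<lambda>t. f (x + t *\<^sub>R axis i 1)) has_real_derivative g i (x + int_vec r)) (at 0)"
      using g_der[of "x + int_vec r" i] by simp
  qed
  have "\<exists>C. \<forall>x. \<bar>g i x\<bar> \<le> C" for i
    using lattice_periodic_bounded[OF g_cont g_per] by blast
  then obtain C where C: "\<And>i x. \<bar>g i x\<bar> \<le> C i" by metis
  \<comment> \<open>A sum of nonnegative bounds serves as one bound common to all
    directions.\<close>
  define M where "M = (\<Sum>i\<in>UNIV. C i)"
  have gM: "\<bar>g i x\<bar> \<le> M" for i x
  proof -
    have "0 \<le> C j" for j using C[of j 0] by simp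
    then have "C i \<le> M" unfolding M_def by (intro member_le_sum) auto
    then show ?thesis using C[of i x] by simp
  qed
  show thesis
  proof (rule that[of M])
    fix N :: nat and x :: "real ^ 'n::{finite,linorder}"
    assume N: "N > 0"
    define ker :: "real \<Rightarrow> real \<Rightarrow> real" where "ker t a = indicator {0..1 / 2} t * sine_kernel N t a" for t a
    have "\<bar>(\<integral>y. f y * (\<Prod>b\<in>Basis. ker (y \<bullet> b) (x \<bullet> b)) \<partial>lborel) - f x\<bar> \<le>
        M / sqrt (real N) * (\<Sum>j<DIM(real ^ 'n::{finite,linorder}). (2 * ln (4 * real N + 3)) ^ j)"
    proof (rule product_kernel_error[OF _ _ cont B])
      show "integrable lborel (\<lambda>t. ker t a)" for a
        unfolding ker_def by (intro lebesgue_integral_Icc_continuous continuous_intros)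
      show "(\<integral>t. \<bar>ker t a\<bar> \<partial>lborel) \<le> 2 * ln (4 * real N + 3)" for a
      proof -
        have "(\<integral>t. \<bar>ker t a\<bar> \<partial>lborel) = (\<integral>t. indicator {0..1 / 2} t * \<bar>sine_kernel N t a\<bar> \<partial>lborel)"
          by (simp add: ker_def abs_mult)
        also have "\<dots> = integral {0..1 / 2} (\<lambda>t. \<bar>sine_kernel N t a\<bar>)"
          by (intro lebesgue_integral_Icc_continuous continuous_intros)
        finally show ?thesis using sine_kernel_L1[of N a] by simp
      qed
    next
      fix z b :: "real ^ 'n::{finite,linorder}"
      assume "b \<in> Basis"
      then obtain i where b: "b = axis i 1" by (auto simp: Basis_vec_def)
      have zb: "z \<bullet> b = z $ i" by (simp add: b inner_axis)
      \<comment> \<open>The point z with its i-th coordinate set to t. Along this line a step of 1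
        is a lattice translation and t to -t is \<open>sign_flip i\<close>, so f restricted to it is
        1-periodic and odd; at \<open>t = z \<bullet> b\<close> the point is z itself.\<close>
      let ?p = "\<lambda>t. z + (t - z \<bullet> b) *\<^sub>R b"
      have p_shift: "?p (s + t) = ?p t + s *\<^sub>R b" for s t
        by (simp add: algebra_simps)
      \<comment> \<open>Partial derivatives are given at parameter 0 only; shifting the base point
        along the line yields them at every t.\<close>
      have der: "((\<lambda>t. f (?p t)) has_real_derivative g i (?p t)) (at t)" for t
        using g_der[of "?p t" i] DERIV_shift[of "\<lambda>t. f (?p t)" "g i (?p t)" 0 t]
        by (simp add: p_shift b[symmetric])
      have contp: "continuous_on S ?p" for S by (intro continuous_intros)
      have "\<bar>integral {0..1 / 2} (\<lambda>u. f (?p u) * sine_kernel N u (z \<bullet> b)) - f (?p (z \<bullet> b))\<bar> \<le> M / sqrt (real N)"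
      proof (rule sine_kernel_error[OF der _ gM _ _ N])
        show "continuous_on UNIV (\<lambda>t. g i (?p t))"
          by (rule continuous_on_compose2[OF g_cont contp]) simp
        show "f (?p (t + 1)) = f (?p t)" for t
        proof -
          have "int_vec (axis i 1) = b" by (simp add: b int_vec_def axis_def vec_eq_iff)
          then have "?p (t + 1) = ?p t + int_vec (axis i 1)"
            using p_shift[of 1 t] by (simp only: scaleR_one add.commute[of t 1])
          then show ?thesis by (simp only: per')
        qed
        show "f (?p (- t)) = - f (?p t)" for t
        proof -
          have "?p (- t) = sign_flip i (?p t)"
            by (simp add: vec_eq_iff sign_flip_def zb) (simp add: b axis_def)
          then show ?thesis by (simp add: odd)
        qed
      qed
      moreover have "(\<integral>t. f (?p t) * ker t (z \<bullet> b) \<partial>lborel) =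
          integral {0..1 / 2} (\<lambda>u. f (?p u) * sine_kernel N u (z \<bullet> b))"
      proof -
        have "(\<integral>t. f (?p t) * ker t (z \<bullet> b) \<partial>lborel) =
            (\<integral>t. indicator {0..1 / 2} t * (f (?p t) * sine_kernel N t (z \<bullet> b)) \<partial>lborel)"
          by (simp add: ker_def mult_ac)
        also have "\<dots> = integral {0..1 / 2} (\<lambda>u. f (?p u) * sine_kernel N u (z \<bullet> b))"
          by (intro lebesgue_integral_Icc_continuous continuous_intros
              continuous_on_compose2[OF cont contp]) simp
        finally show ?thesis .
      qed
      ultimately show "\<bar>(\<integral>t. f (?p t) * ker t (z \<bullet> b) \<partial>lborel) - f z\<bar> \<le> M / sqrt (real N)"
        by simp
    qed
    then show "\<bar>(\<Sum>m\<in>P_plus_upto N. sin_plus_coeff f m * sin_plus m x) - f x\<bar> \<le>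
        M / sqrt (real N) * (\<Sum>j<CARD('n). (2 * ln (4 * real N + 3)) ^ j)"
      by (simp add: partial_sum_eq_integral[OF cont sym] ker_def)
  qed
qed

theorem mainTheorem9:
  fixes f :: "real ^ 'n::{finite,linorder} \<Rightarrow> real"
  assumes "continuous_on UNIV f"
    and "continuous_partial_derivs f"
    and "\<And>x w r. w permutes (UNIV :: 'n set) \<Longrightarrow> f (perm_act w x + int_vec r) = f x"
    and "\<And>x i. f (sign_flip i x) = - f x"
  shows "(\<forall>x. (\<lambda>N. \<Sum>m\<in>P_plus_upto N. sin_plus_coeff f m * sin_plus m x) \<longlonglongrightarrow> f x) \<and>
    ((\<lambda>m. real (card (stab m)) * \<bar>sin_plus_coeff f m\<bar>\<^sup>2) has_sum
       (2 ^ (2 * CARD('n)) * (LINT x:F_closed|lborel. \<bar>f x\<bar>\<^sup>2))) P_plus"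
proof -
  define T where "T N x = (\<Sum>m\<in>P_plus_upto N. sin_plus_coeff f m * sin_plus m x)" for N x
  obtain M where M: "\<And>N x. N > 0 \<Longrightarrow>
    \<bar>T N x - f x\<bar> \<le> M / sqrt (real N) * (\<Sum>j<CARD('n). (2 * ln (4 * real N + 3)) ^ j)"
    using sine_partial_sum_uniform_error[OF assms] unfolding T_def by blast
  define E where "E N = M / sqrt (real N) * (\<Sum>j<CARD('n). (2 * ln (4 * real N + 3)) ^ j)" for N
  have E0: "E \<longlonglongrightarrow> 0"
    unfolding E_def[abs_def] by (rule sine_kernel_error_tendsto_0)
  have TE: "\<bar>T N x - f x\<bar> \<le> E N" if "N > 0" for N x
    using M[OF that] by (simp add: E_def)
  have conv: "(\<lambda>N. T N x) \<longlonglongrightarrow> f x" for x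
  proof -
    have "(\<lambda>N. T N x - f x) \<longlonglongrightarrow> 0"
      by (rule tendsto_rabs_zero_cancel, rule tendsto_sandwich[OF _ _ tendsto_const E0])
         (auto intro!: eventually_sequentiallyI[of 1] TE)
    then show ?thesis by (simp add: LIM_zero_iff)
  qed
  let ?F = "F_closed :: (real ^ 'n::{finite,linorder}) set"
  have contT: "continuous_on UNIV (T N)" for N
    unfolding T_def[abs_def] by (intro continuous_intros)
  note intF = integrable_F_closed
  \<comment> \<open>One factor c_m of the square stays as it is and the other, times |G_m|, is
    replaced by its defining integral. The sum then assembles to the integral of f against the
    partial sum.\<close>
  have sum_eq: "(\<Sum>m\<in>P_plus_upto N. real (card (stab m)) * \<bar>sin_plus_coeff f m\<bar>\<^sup>2) =
      2 ^ (2 * CARD('n)) * (LINT x:?F|lborel. f x * T N x)" for N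
  proof -
    have "real (card (stab m)) * \<bar>sin_plus_coeff f m\<bar>\<^sup>2 =
        2 ^ (2 * CARD('n)) * (LINT x:?F|lborel. f x * (sin_plus_coeff f m * sin_plus m x))" for m :: "int ^ 'n::{finite,linorder}"
    proof -
      have "(LINT x:?F|lborel. f x * (sin_plus_coeff f m * sin_plus m x)) =
          sin_plus_coeff f m * (LINT x:?F|lborel. f x * sin_plus m x)"
        by (simp flip: set_integral_mult_right add: mult_ac)
      moreover have "real (card (stab m)) * sin_plus_coeff f m =
          2 ^ (2 * CARD('n)) * (LINT x:?F|lborel. f x * sin_plus m x)"
        using stab_pos[of m] by (auto simp: sin_plus_coeff_def field_simps)
      ultimately show ?thesis
        by (simp add: power2_eq_square)
    qed
    then have "(\<Sum>m\<in>P_plus_upto N. real (card (stab m)) * \<bar>sin_plus_coeff f m\<bar>\<^sup>2) =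
        2 ^ (2 * CARD('n)) * (\<Sum>m\<in>P_plus_upto N. LINT x:?F|lborel. f x * (sin_plus_coeff f m * sin_plus m x))"
      by (simp add: sum_distrib_left)
    also have "(\<Sum>m\<in>P_plus_upto N. LINT x:?F|lborel. f x * (sin_plus_coeff f m * sin_plus m x)) =
        (LINT x:?F|lborel. (\<Sum>m\<in>P_plus_upto N. f x * (sin_plus_coeff f m * sin_plus m x)))"
      unfolding set_lebesgue_integral_def scaleR_sum_right
      by (rule Bochner_Integration.integral_sum[symmetric])
         (intro intF[unfolded set_integrable_def] continuous_intros assms(1))
    finally show ?thesis by (simp add: T_def sum_distrib_left)
  qed
  \<comment> \<open>Uniform convergence passes under the integral: the difference is at most
    \<open>E N\<close> times the L1 norm of f on the compact domain.\<close>
  have "(\<lambda>N. (LINT x:?F|lborel. f x * T N x)) \<longlonglongrightarrow> (LINT x:?F|lborel. f x * f x)"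
  proof (rule LIM_zero_cancel, rule Lim_null_comparison)
    show "(\<lambda>N. E N * (LINT x:?F|lborel. \<bar>f x\<bar>)) \<longlonglongrightarrow> 0"
      using tendsto_mult_left_zero[OF E0] .
    show "\<forall>\<^sub>F N in sequentially. norm ((LINT x:?F|lborel. f x * T N x) - (LINT x:?F|lborel. f x * f x)) \<le>
        E N * (LINT x:?F|lborel. \<bar>f x\<bar>)"
    proof (rule eventually_sequentiallyI[of 1])
      fix N :: nat assume N: "1 \<le> N"
      have "(LINT x:?F|lborel. f x * T N x) - (LINT x:?F|lborel. f x * f x) =
          (LINT x:?F|lborel. f x * T N x - f x * f x)"
        by (intro set_integral_diff(2)[symmetric] intF continuous_intros assms(1) contT)
      also have "norm \<dots> \<le> (LINT x:?F|lborel. norm (f x * T N x - f x * f x))"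
        by (intro set_integral_norm_bound intF continuous_intros assms(1) contT)
      also have "\<dots> \<le> (LINT x:?F|lborel. E N * \<bar>f x\<bar>)"
      proof (rule set_integral_mono)
        fix x
        have "norm (f x * T N x - f x * f x) = \<bar>f x\<bar> * \<bar>T N x - f x\<bar>"
          by (simp add: abs_mult[symmetric] algebra_simps)
        also have "\<dots> \<le> \<bar>f x\<bar> * E N"
          using TE[of N x] N by (intro mult_left_mono) auto
        finally show "norm (f x * T N x - f x * f x) \<le> E N * \<bar>f x\<bar>" by (simp add: mult.commute)
      qed (intro intF continuous_intros assms(1) contT)+
      also have "\<dots> = E N * (LINT x:?F|lborel. \<bar>f x\<bar>)" by simp
      finally show "norm ((LINT x:?F|lborel. f x * T N x) - (LINT x:?F|lborel. f x * f x)) \<le>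
        E N * (LINT x:?F|lborel. \<bar>f x\<bar>)" .
    qed
  qed
  then have lim: "(\<lambda>N. \<Sum>m\<in>P_plus_upto N. real (card (stab m)) * \<bar>sin_plus_coeff f m\<bar>\<^sup>2)
      \<longlonglongrightarrow> 2 ^ (2 * CARD('n)) * (LINT x:?F|lborel. \<bar>f x\<bar>\<^sup>2)"
    unfolding sum_eq by (intro tendsto_mult_left) (simp add: power2_eq_square)
  have "(\<Union>N. P_plus_upto N) = (P_plus :: (int ^ 'n::{finite,linorder}) set)"
  proof (intro equalityI subsetI)
    fix m :: "int ^ 'n::{finite,linorder}" assume m: "m \<in> P_plus"
    have "m $ i \<le> int (nat (Max (range (($) m))))" for i
    proof -
      have "m $ i \<le> Max (range (($) m))" by (rule Max_ge) auto
      then show ?thesis by linarith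
    qed
    then have "m \<in> P_plus_upto (nat (Max (range (($) m))))"
      using m unfolding P_plus_upto_def by blast
    then show "m \<in> (\<Union>N. P_plus_upto N)" by blast
  qed (auto simp: P_plus_upto_def)
  moreover have "incseq (P_plus_upto :: nat \<Rightarrow> (int ^ 'n::{finite,linorder}) set)"
    by (auto simp: incseq_def P_plus_upto_def intro: order_trans)
  ultimately show ?thesis
    using conv lim
    by (intro conjI allI has_sum_exhausting[of _ _ P_plus_upto])
       (auto simp: T_def finite_P_plus_upto)
qed

end
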